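(* Let $\{p_n(x)\}_{n\ge0}$ and $\{q_n(x)\}_{n\ge0}$ be sequences of polynomials with $\deg p_n(x)=\deg q_n(x)=n$, and let $\sigma_{n,k}$ and $\nu_{n,k}$ be the mixed moments and coefficients of $\{p_n(x)\}_{n\ge0}$ relative to $\{q_n(x)\}_{n\ge0}$, i.e. \[ q_n(x)=\sum_{k=0}^n\sigma_{n,k}\,p_k(x),\qquad p_n(x)=\sum_{k=0}^n\nu_{n,k}\,q_k(x). \] If $w$ is a weight system on the lecture hall graph such that \[ \sigma_{n,k}=h^w_{n,k}\quad\text{for all } n\ge k\ge0, \] then \[ \nu_{n,k}=(-1)^{n-k}e^w_{n,k}\quad\text{for all } n\ge k\ge 0. \] Conversely, if $w$ is a weight system such that $\nu_{n,k}=(-1)^{n-k}e^w_{n,k}$ for all $n\ge k\ge0$, then $\sigma_{n,k}=h^w_{n,k}$ for all $n\ge k\ge0$.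
   Context: Lecture hall graph. For integers $t\ge0$, $0\le j\le i$ put $v^t_{i,j}=(i,\,t+\frac{j}{i+1})$, and set $v^t_{i,i+1}:=v^{t+1}_{i,0}$. The vertices of the lecture hall graph are all $v^t_{i,j}$; its edges join $v^t_{i,j}$ with $v^t_{i,j+1}$ (vertical edges) and $v^t_{i,j}$ with $v^t_{i+1,j}$, for $t\ge 0$, $0\le j\le i$. An east step is a directed edge $(v^t_{i,j},v^t_{i+1,j})$; a south (resp. north) step is a vertical edge directed downwards, $(v^t_{i,j+1},v^t_{i,j})$ (resp. upwards, $(v^t_{i,j},v^t_{i,j+1})$). A weight system $w$ assigns a weight $w(t;i,j)$ to each east step $(v^t_{i,j},v^t_{i+1,j})$. The weight $w(p)$ of a path is the product of the weights of its east steps. $\mathrm{SE}((k,\infty)\to(n,0))$ is the set of paths $(\dots,v_2,v_1,v_0)$ with $v_0=(n,0)$, $\lim_{m\to\infty}v_m=(k,\infty)$, and each $(v_{m+1},v_m)$ a south or east step. $\mathrm{NE}^*((k,0)\to(n,\infty))$ is the set of paths $(v_0,v_1,v_2,\dots)$ with $v_0=(k,0)$, $\lim_{m\to\infty}v_m=(n,\infty)$, each $(v_m,v_{m+1})$ a north or east step, and with no two consecutive east steps. Define \[ h^w_{n,k}=\sum_{p\in \mathrm{SE}((k,\infty)\to(n,0))}w(p),\qquad e^w_{n,k}=\sum_{p\in \mathrm{NE}^*((k,0)\to(n,\infty))}w(p) \] (so $h^w_{n,n}=e^w_{n,n}=1$ and both vanish if $n<k$). The polynomials have coefficients in a field containing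 the weights. Infinite sums are understood formally: weights are assumed to be such that these sums are well defined, e.g. finitely many nonzero weights $w(t;i,j)$ for each $i$, or weights in a ring of formal power series such that for each $i$ the family $(w(t;i,j))_{t,j}$ is summable (each monomial has nonzero coefficient in only finitely many members). *)

theory Defs
  imports "HOL-Analysis.Analysis" "HOL-Computational_Algebra.Polynomial"
begin

text \<open>
  Formal infinite sums.  The weights lie in a subring \<open>R\<close> of the coefficient field, and
  \<open>R\<close> carries the Hausdorff linear topology in which the members of a family \<open>\<I>\<close> of ideals of
  \<open>R\<close> form a subbase of neighbourhoods of 0.  A formal sum is an unconditional sum for this
  topology.  The two standard situations are instances, as shown below:
  \<^item> \<open>R\<close> is the whole field and \<open>\<I>\<close> consists of the zero ideal; summable then means finitely many
    nonzero terms;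
  \<^item> \<open>R\<close> is a ring of formal power series, with coefficientwise convergence; summable then means
    that each monomial has a nonzero coefficient in only finitely many terms.
\<close>

locale formal_ring =
  fixes R :: "'k::field set" and \<I> :: "'k set set"
  assumes one_closed: "1 \<in> R"
    and diff_closed: "\<And>x y. x \<in> R \<Longrightarrow> y \<in> R \<Longrightarrow> x - y \<in> R"
    and mult_closed: "\<And>x y. x \<in> R \<Longrightarrow> y \<in> R \<Longrightarrow> x * y \<in> R"
    and ideal_subset: "\<And>I. I \<in> \<I> \<Longrightarrow> I \<subseteq> R"
    and ideal_zero: "\<And>I. I \<in> \<I> \<Longrightarrow> 0 \<in> I"
    and ideal_diff: "\<And>I x y. I \<in> \<I> \<Longrightarrow> x \<in> I \<Longrightarrow> y \<in> I \<Longrightarrow> x - y \<in> I"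
    and ideal_mult: "\<And>I x y. I \<in> \<I> \<Longrightarrow> x \<in> R \<Longrightarrow> y \<in> I \<Longrightarrow> x * y \<in> I"
    and separated: "\<Inter>\<I> = {0}"

definition has_formal_sum :: "'k::field set set \<Rightarrow> ('p \<Rightarrow> 'k) \<Rightarrow> 'p set \<Rightarrow> 'k \<Rightarrow> bool" where
  "has_formal_sum \<I> f A s \<longleftrightarrow>
     (\<forall>I\<in>\<I>. \<forall>\<^sub>F F in finite_subsets_at_top A. sum f F - s \<in> I)"

definition formally_summable :: "'k::field set set \<Rightarrow> ('p \<Rightarrow> 'k) \<Rightarrow> 'p set \<Rightarrow> bool" where
  "formally_summable \<I> f A \<longleftrightarrow> (\<exists>s. has_formal_sum \<I> f A s)"

definition formal_sum :: "'k::field set set \<Rightarrow> ('p \<Rightarrow> 'k) \<Rightarrow> 'p set \<Rightarrow> 'k" where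
  "formal_sum \<I> f A = (THE s. has_formal_sum \<I> f A s)"

lemma (in formal_ring) has_formal_sum_unique:
  assumes "has_formal_sum \<I> f A s" "has_formal_sum \<I> f A s'"
  shows "s = s'"
proof -
  have "s' - s \<in> I" if I: "I \<in> \<I>" for I
  proof -
    have "\<forall>\<^sub>F F in finite_subsets_at_top A. sum f F - s \<in> I \<and> sum f F - s' \<in> I"
      using assms I unfolding has_formal_sum_def by (auto intro: eventually_conj)
    then obtain F where "sum f F - s \<in> I" "sum f F - s' \<in> I"
      using eventually_happens'[OF finite_subsets_at_top_neq_bot] by blast
    from ideal_diff[OF I this] show ?thesis by simp
  qed
  then have "s' - s \<in> \<Inter>\<I>" by blast
  then show ?thesis using separated by auto
qed

lemma (in formal_ring) formal_sum_eq:
  "has_formal_sum \<I> f A s \<Longrightarrow> formal_sum \<I> f A = s"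
  unfolding formal_sum_def by (blast intro: has_formal_sum_unique)

lemma eventually_sum_eq_iff:
  fixes f :: "'p \<Rightarrow> 'c::ab_group_add"
  shows "(\<forall>\<^sub>F F in finite_subsets_at_top A. sum f F = s) \<longleftrightarrow>
         finite {a \<in> A. f a \<noteq> 0} \<and> s = sum f {a \<in> A. f a \<noteq> 0}"
proof
  assume "\<forall>\<^sub>F F in finite_subsets_at_top A. sum f F = s"
  then obtain F where F: "finite F" "F \<subseteq> A"
    and s: "\<And>G. finite G \<Longrightarrow> F \<subseteq> G \<Longrightarrow> G \<subseteq> A \<Longrightarrow> sum f G = s"
    unfolding eventually_finite_subsets_at_top by blast
  have sub: "{a \<in> A. f a \<noteq> 0} \<subseteq> F"
  proof (rule subsetI, rule ccontr)
    fix a assume a: "a \<in> {a \<in> A. f a \<noteq> 0}" "a \<notin> F"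
    then have "sum f (insert a F) = f a + sum f F" using F by simp
    moreover have "sum f (insert a F) = s" using s[of "insert a F"] a F by blast
    moreover have "sum f F = s" using s[of F] F by simp
    ultimately show False using a by simp
  qed
  have "sum f F = s" using F by (auto intro!: s)
  moreover have "sum f F = sum f {a \<in> A. f a \<noteq> 0}"
    by (rule sum.mono_neutral_right) (use F sub in auto)
  ultimately show "finite {a \<in> A. f a \<noteq> 0} \<and> s = sum f {a \<in> A. f a \<noteq> 0}"
    using F(1) sub finite_subset[OF sub] by simp
next
  assume h: "finite {a \<in> A. f a \<noteq> 0} \<and> s = sum f {a \<in> A. f a \<noteq> 0}"
  have "sum f G = s" if "finite G \<and> {a \<in> A. f a \<noteq> 0} \<subseteq> G \<and> G \<subseteq> A" for G
  proof -
    have "sum f G = sum f {a \<in> A. f a \<noteq> 0}"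
      by (rule sum.mono_neutral_right) (use that in auto)
    then show ?thesis using h by simp
  qed
  then show "\<forall>\<^sub>F F in finite_subsets_at_top A. sum f F = s"
    unfolding eventually_finite_subsets_at_top using h
    by (intro exI[of _ "{a \<in> A. f a \<noteq> 0}"] conjI) blast+
qed

lemma formal_ring_discrete: "formal_ring (UNIV :: 'k::field set) {{0}}"
  by unfold_locales auto

lemma has_formal_sum_discrete_iff:
  "has_formal_sum {{0}} f A s \<longleftrightarrow>
     finite {a \<in> A. f a \<noteq> 0} \<and> s = (\<Sum>a | a \<in> A \<and> f a \<noteq> 0. f a)"
  by (simp add: has_formal_sum_def flip: eventually_sum_eq_iff)

text \<open>
  In the next locale \<open>'m\<close> is the (additively written) monoid of monomials, for instance
  \<open>'v \<Rightarrow>\<^sub>0 nat\<close> for a set \<open>'v\<close> of variables, and \<open>coef m x\<close> is the coefficient of the monomial \<open>m\<close>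
  in \<open>x\<close>; it identifies \<open>R\<close> with a subring of the ring of formal power series over \<open>'c\<close>.
\<close>

locale power_series_ring =
  fixes R :: "'k::field set" and coef :: "'m::comm_monoid_add \<Rightarrow> 'k \<Rightarrow> 'c::comm_ring_1"
  assumes one_closed: "1 \<in> R"
    and diff_closed: "\<And>x y. x \<in> R \<Longrightarrow> y \<in> R \<Longrightarrow> x - y \<in> R"
    and mult_closed: "\<And>x y. x \<in> R \<Longrightarrow> y \<in> R \<Longrightarrow> x * y \<in> R"
    and finite_divisors: "\<And>m::'m. finite {a. \<exists>b. a + b = m}"
    and coef_diff: "\<And>m x y. x \<in> R \<Longrightarrow> y \<in> R \<Longrightarrow> coef m (x - y) = coef m x - coef m y"
    and coef_mult: "\<And>m x y. x \<in> R \<Longrightarrow> y \<in> R \<Longrightarrow>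
          coef m (x * y) = (\<Sum>(a, b) | a + b = m. coef a x * coef b y)"
    and coef_ext: "\<And>x y. x \<in> R \<Longrightarrow> y \<in> R \<Longrightarrow> (\<And>m. coef m x = coef m y) \<Longrightarrow> x = y"
begin

definition coef_ideals :: "'k set set" where
  "coef_ideals = range (\<lambda>m. {x \<in> R. \<forall>a b. a + b = m \<longrightarrow> coef a x = 0})"

lemma zero_closed: "0 \<in> R"
  using diff_closed[OF one_closed one_closed] by simp

lemma coef_zero: "coef m 0 = 0"
  using coef_diff[OF one_closed one_closed, of m] by simp

lemma add_closed: "x \<in> R \<Longrightarrow> y \<in> R \<Longrightarrow> x + y \<in> R"
  using diff_closed[of x "0 - y"] diff_closed[of 0 y] zero_closed by simp

lemma coef_add: "x \<in> R \<Longrightarrow> y \<in> R \<Longrightarrow> coef m (x + y) = coef m x + coef m y"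
  using coef_diff[of "x + y" y m] add_closed[of x y] by simp

lemma sum_closed: "(\<And>a. a \<in> F \<Longrightarrow> f a \<in> R) \<Longrightarrow> sum f F \<in> R"
  by (induction F rule: infinite_finite_induct) (auto simp: zero_closed add_closed)

lemma coef_sum: "(\<And>a. a \<in> F \<Longrightarrow> f a \<in> R) \<Longrightarrow> coef m (sum f F) = (\<Sum>a\<in>F. coef m (f a))"
  by (induction F rule: infinite_finite_induct) (auto simp: coef_zero coef_add sum_closed)

lemma formal_ring: "formal_ring R coef_ideals"
proof
  show "1 \<in> R" by (rule one_closed)
  show "x - y \<in> R" if "x \<in> R" "y \<in> R" for x y using that by (rule diff_closed)
  show "x * y \<in> R" if "x \<in> R" "y \<in> R" for x y using that by (rule mult_closed)
  show "I \<subseteq> R" if "I \<in> coef_ideals" for I using that by (auto simp: coef_ideals_def)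
  show "0 \<in> I" if "I \<in> coef_ideals" for I
    using that by (auto simp: coef_ideals_def zero_closed coef_zero)
  show "x - y \<in> I" if I: "I \<in> coef_ideals" and "x \<in> I" "y \<in> I" for I x y
  proof -
    obtain m where m: "I = {x \<in> R. \<forall>a b. a + b = m \<longrightarrow> coef a x = 0}"
      using I by (auto simp: coef_ideals_def)
    have "coef a (x - y) = 0" if "a + b = m" for a b
    proof -
      have "coef a x = 0" "coef a y = 0" "x \<in> R" "y \<in> R"
        using \<open>x \<in> I\<close> \<open>y \<in> I\<close> that unfolding m by blast+
      then show ?thesis by (simp add: coef_diff)
    qed
    moreover have "x - y \<in> R" using that m by (intro diff_closed) blast+
    ultimately show ?thesis unfolding m by blast
  qed
  show "x * y \<in> I" if I: "I \<in> coef_ideals" and x: "x \<in> R" and y: "y \<in> I" for I x y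
  proof -
    obtain m where m: "I = {x \<in> R. \<forall>a b. a + b = m \<longrightarrow> coef a x = 0}"
      using I by (auto simp: coef_ideals_def)
    have "coef a (x * y) = 0" if ab: "a + b = m" for a b
    proof -
      have "coef c x * coef d y = 0" if cd: "c + d = a" for c d
      proof -
        have "d + (c + b) = m" using ab cd by (simp add: ac_simps)
        then show ?thesis using y m by auto
      qed
      then show ?thesis using x y m by (auto simp: coef_mult intro!: sum.neutral)
    qed
    then show ?thesis using x y m by (auto simp: mult_closed)
  qed
  have "x = 0" if x: "x \<in> \<Inter>coef_ideals" for x
  proof -
    have *: "x \<in> R \<and> coef m x = 0" for m
    proof -
      have "x \<in> {x \<in> R. \<forall>a b. a + b = m \<longrightarrow> coef a x = 0}"
        using x unfolding coef_ideals_def by blast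
      then show ?thesis by (auto intro: add_0_right)
    qed
    show ?thesis by (rule coef_ext) (use * zero_closed coef_zero in auto)
  qed
  moreover have "0 \<in> \<Inter>coef_ideals" by (auto simp: coef_ideals_def zero_closed coef_zero)
  ultimately show "\<Inter>coef_ideals = {0}" by blast
qed

lemma has_formal_sum_iff:
  assumes f: "\<And>a. a \<in> A \<Longrightarrow> f a \<in> R" and s: "s \<in> R"
  shows "has_formal_sum coef_ideals f A s \<longleftrightarrow>
           (\<forall>m. finite {a \<in> A. coef m (f a) \<noteq> 0} \<and>
                coef m s = (\<Sum>a | a \<in> A \<and> coef m (f a) \<noteq> 0. coef m (f a)))"
proof -
  have mem: "sum f F - s \<in> {x \<in> R. \<forall>a b. a + b = m \<longrightarrow> coef a x = 0} \<longleftrightarrow>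
      (\<forall>a\<in>{a. \<exists>b. a + b = m}. (\<Sum>x\<in>F. coef a (f x)) = coef a s)" if "F \<subseteq> A" for F m
  proof -
    have "\<And>a. a \<in> F \<Longrightarrow> f a \<in> R" using f that by auto
    then show ?thesis using s by (auto simp: coef_diff coef_sum sum_closed diff_closed)
  qed
  have sub: "\<forall>\<^sub>F F in finite_subsets_at_top A. F \<subseteq> A"
    by (rule eventually_finite_subsets_at_top_weakI)
  have "has_formal_sum coef_ideals f A s \<longleftrightarrow>
      (\<forall>m. \<forall>\<^sub>F F in finite_subsets_at_top A.
         \<forall>a\<in>{a. \<exists>b. a + b = m}. (\<Sum>x\<in>F. coef a (f x)) = coef a s)"
    unfolding has_formal_sum_def coef_ideals_def ball_simps(9) ball_UNIV
    by (intro all_cong1 eventually_subst eventually_mono[OF sub]) (erule mem)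
  also have "\<dots> \<longleftrightarrow> (\<forall>m. \<forall>a\<in>{a. \<exists>b. a + b = m}. \<forall>\<^sub>F F in finite_subsets_at_top A.
         (\<Sum>x\<in>F. coef a (f x)) = coef a s)"
    by (intro all_cong1 eventually_ball_finite_distrib finite_divisors)
  also have "\<dots> \<longleftrightarrow> (\<forall>m. \<forall>\<^sub>F F in finite_subsets_at_top A. (\<Sum>x\<in>F. coef m (f x)) = coef m s)"
    by blast
  finally show ?thesis by (simp add: eventually_sum_eq_iff)
qed

end

text \<open>
  The lecture hall graph.  The formula below also covers the convention that \<open>lh_vertex t i (i + 1)\<close>
  is \<open>lh_vertex (t + 1) i 0\<close>.
\<close>

definition lh_vertex :: "nat \<Rightarrow> nat \<Rightarrow> nat \<Rightarrow> nat \<times> real" where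
  "lh_vertex t i j = (i, real t + real j / real (i + 1))"

lemma lh_vertex_wrap: "lh_vertex t i (i + 1) = lh_vertex (t + 1) i 0"
  by (simp add: lh_vertex_def add_divide_distrib[symmetric])

definition east_step :: "nat \<times> real \<Rightarrow> nat \<times> real \<Rightarrow> bool" where
  "east_step u v \<longleftrightarrow> (\<exists>t i j. j \<le> i \<and> u = lh_vertex t i j \<and> v = lh_vertex t (i + 1) j)"

definition south_step :: "nat \<times> real \<Rightarrow> nat \<times> real \<Rightarrow> bool" where
  "south_step u v \<longleftrightarrow> (\<exists>t i j. j \<le> i \<and> u = lh_vertex t i (j + 1) \<and> v = lh_vertex t i j)"

definition north_step :: "nat \<times> real \<Rightarrow> nat \<times> real \<Rightarrow> bool" where
  "north_step u v \<longleftrightarrow> (\<exists>t i j. j \<le> i \<and> u = lh_vertex t i j \<and> v = lh_vertex t i (j + 1))"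

definition tends_to_top :: "(nat \<Rightarrow> nat \<times> real) \<Rightarrow> nat \<Rightarrow> bool" where
  "tends_to_top v k \<longleftrightarrow> (\<lambda>m. (fst (v m), ereal (snd (v m)))) \<longlonglongrightarrow> (k, \<infinity>)"

text \<open>
  A path in \<open>SE_paths k n\<close> is indexed from its endpoint \<open>v 0 = (n, 0)\<close> backwards, so its directed
  steps are the pairs \<open>(v (m + 1), v m)\<close>.
\<close>

definition SE_paths :: "nat \<Rightarrow> nat \<Rightarrow> (nat \<Rightarrow> nat \<times> real) set" where
  "SE_paths k n = {v. v 0 = (n, 0) \<and> tends_to_top v k \<and>
     (\<forall>m. south_step (v (m + 1)) (v m) \<or> east_step (v (m + 1)) (v m))}"

definition NE_star_paths :: "nat \<Rightarrow> nat \<Rightarrow> (nat \<Rightarrow> nat \<times> real) set" where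
  "NE_star_paths k n = {v. v 0 = (k, 0) \<and> tends_to_top v n \<and>
     (\<forall>m. north_step (v m) (v (m + 1)) \<or> east_step (v m) (v (m + 1))) \<and>
     \<not> (\<exists>m. east_step (v m) (v (m + 1)) \<and> east_step (v (m + 1)) (v (m + 2)))}"

text \<open>
  A weight system is a function \<open>w\<close>, where \<open>w t i j\<close> is relevant only for \<open>j \<le> i\<close>.  The weight of a
  path with set of directed steps \<open>S\<close> is a product over the labels of its east steps.  Distinct
  east steps have distinct labels, a path uses each east step at most once, and a path in
  \<open>SE_paths\<close> or \<open>NE_star_paths\<close> has only finitely many, since its first coordinate is eventually
  constant.
\<close>

definition steps_weight ::
  "(nat \<Rightarrow> nat \<Rightarrow> nat \<Rightarrow> 'k::field) \<Rightarrow> ((nat \<times> real) \<times> (nat \<times> real)) set \<Rightarrow> 'k" where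
  "steps_weight w S =
     (\<Prod>(t, i, j) | j \<le> i \<and> (lh_vertex t i j, lh_vertex t (i + 1) j) \<in> S. w t i j)"

definition SE_weight :: "(nat \<Rightarrow> nat \<Rightarrow> nat \<Rightarrow> 'k::field) \<Rightarrow> (nat \<Rightarrow> nat \<times> real) \<Rightarrow> 'k" where
  "SE_weight w v = steps_weight w (range (\<lambda>m. (v (m + 1), v m)))"

definition NE_weight :: "(nat \<Rightarrow> nat \<Rightarrow> nat \<Rightarrow> 'k::field) \<Rightarrow> (nat \<Rightarrow> nat \<times> real) \<Rightarrow> 'k" where
  "NE_weight w v = steps_weight w (range (\<lambda>m. (v m, v (m + 1))))"

definition lh_h ::
  "'k::field set set \<Rightarrow> (nat \<Rightarrow> nat \<Rightarrow> nat \<Rightarrow> 'k) \<Rightarrow> nat \<Rightarrow> nat \<Rightarrow> 'k" where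
  "lh_h \<I> w n k = formal_sum \<I> (SE_weight w) (SE_paths k n)"

definition lh_e ::
  "'k::field set set \<Rightarrow> (nat \<Rightarrow> nat \<Rightarrow> nat \<Rightarrow> 'k) \<Rightarrow> nat \<Rightarrow> nat \<Rightarrow> 'k" where
  "lh_e \<I> w n k = formal_sum \<I> (NE_weight w) (NE_star_paths k n)"

text \<open>The weights lie in \<open>R\<close> and the sums defining \<open>lh_h\<close> and \<open>lh_e\<close> are well defined.\<close>

definition admissible_weights ::
  "'k::field set \<Rightarrow> 'k set set \<Rightarrow> (nat \<Rightarrow> nat \<Rightarrow> nat \<Rightarrow> 'k) \<Rightarrow> bool" where
  "admissible_weights R \<I> w \<longleftrightarrow>
     (\<forall>t i j. j \<le> i \<longrightarrow> w t i j \<in> R) \<and>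
     (\<forall>n k. formally_summable \<I> (SE_weight w) (SE_paths k n)) \<and>
     (\<forall>n k. formally_summable \<I> (NE_weight w) (NE_star_paths k n))"

definition polynomial_sequence :: "(nat \<Rightarrow> 'k::field poly) \<Rightarrow> bool" where
  "polynomial_sequence p \<longleftrightarrow> (\<forall>n. p n \<noteq> 0 \<and> degree (p n) = n)"

definition mixed_moments ::
  "(nat \<Rightarrow> 'k::field poly) \<Rightarrow> (nat \<Rightarrow> 'k poly) \<Rightarrow> (nat \<Rightarrow> nat \<Rightarrow> 'k) \<Rightarrow> bool" where
  "mixed_moments p q \<sigma> \<longleftrightarrow> (\<forall>n. q n = (\<Sum>k=0..n. smult (\<sigma> n k) (p k)))"

definition mixed_coefficients ::
  "(nat \<Rightarrow> 'k::field poly) \<Rightarrow> (nat \<Rightarrow> 'k poly) \<Rightarrow> (nat \<Rightarrow> nat \<Rightarrow> 'k) \<Rightarrow> bool" where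
  "mixed_coefficients p q \<nu> \<longleftrightarrow> (\<forall>n. p n = (\<Sum>k=0..n. smult (\<nu> n k) (q k)))"

end

theory Submission
  imports Defs
begin

text \<open>
  Column \<open>i\<close> of the graph is identified with the rows \<open>r = 0, 1, 2, \<dots>\<close> at height \<open>r / (i + 1)\<close>; the
  east step from row \<open>r\<close> then leads to row \<open>east_row i r = r + r div (i + 1)\<close> of the next column.
  A path is determined by the rows \<open>z i\<close> from which its east steps start: the paths defining
  \<open>h\<close> are the \<open>z\<close> with \<open>z (i + 1) \<le> east_row i (z i)\<close>, and those defining \<open>e\<close>
  are the \<open>z\<close> with \<open>east_row i (z i) < z (i + 1)\<close>.  These conditions are complementary.  So among the
  pairs of an \<open>e\<close>-path from \<open>m\<close> to \<open>k\<close> and an \<open>h\<close>-path from \<open>k\<close> to \<open>n\<close>, for all \<open>k\<close>, moving the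
  east step adjacent to column \<open>k\<close> from one path to the other is a weight-preserving involution
  that changes the parity of \<open>k\<close>.  Hence the matrices \<open>h\<close> and \<open>(- 1) ^ (n - k) * e\<close> are mutually
  inverse, just as \<open>\<sigma>\<close> and \<open>\<nu>\<close> are.
\<close>

subsection \<open>Formal sums\<close>

context formal_ring
begin

lemma zero_closed: "0 \<in> R"
  using diff_closed[OF one_closed one_closed] by simp

lemma uminus_closed: "x \<in> R \<Longrightarrow> - x \<in> R"
  using diff_closed[OF zero_closed, of x] by simp

lemma add_closed: "x \<in> R \<Longrightarrow> y \<in> R \<Longrightarrow> x + y \<in> R"
  using diff_closed[of x "- y"] uminus_closed by simp

lemma sum_closed: "(\<And>a. a \<in> F \<Longrightarrow> f a \<in> R) \<Longrightarrow> sum f F \<in> R"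
  by (induction F rule: infinite_finite_induct) (auto simp: zero_closed add_closed)

lemma prod_closed: "(\<And>a. a \<in> F \<Longrightarrow> f a \<in> R) \<Longrightarrow> prod f F \<in> R"
  by (induction F rule: infinite_finite_induct) (auto simp: one_closed mult_closed)

lemma power_closed: "x \<in> R \<Longrightarrow> x ^ n \<in> R"
  by (induction n) (auto simp: one_closed mult_closed)

lemma ideal_uminus: "I \<in> \<I> \<Longrightarrow> x \<in> I \<Longrightarrow> - x \<in> I"
  using ideal_diff[OF _ ideal_zero, of I x] by simp

lemma ideal_add: "I \<in> \<I> \<Longrightarrow> x \<in> I \<Longrightarrow> y \<in> I \<Longrightarrow> x + y \<in> I"
  using ideal_diff[of I x "- y"] ideal_uminus by simp

lemma ideal_sum: "I \<in> \<I> \<Longrightarrow> (\<And>a. a \<in> F \<Longrightarrow> f a \<in> I) \<Longrightarrow> sum f F \<in> I"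
  by (induction F rule: infinite_finite_induct) (auto simp: ideal_zero ideal_add)

text \<open>The empty family would have intersection \<open>UNIV\<close>, contradicting
  separatedness because 1 differs from 0. Some ideal is needed to place limits in
  \<open>R\<close>.\<close>

lemma ideals_nonempty: "\<I> \<noteq> {}"
proof
  assume "\<I> = {}"
  then have "(1::'k) \<in> {0}" using separated by auto
  then show False by simp
qed

text \<open>Two partial sums beyond \<open>F\<close> that differ by one term both agree with
  \<open>s\<close> modulo \<open>I\<close>, so that term lies in \<open>I\<close>.\<close>

lemma has_formal_sumE:
  assumes "has_formal_sum \<I> f A s" "I \<in> \<I>"
  obtains F where "finite F" "F \<subseteq> A" "sum f F - s \<in> I" "\<And>a. a \<in> A - F \<Longrightarrow> f a \<in> I"
    "\<And>G. finite G \<Longrightarrow> F \<subseteq> G \<Longrightarrow> G \<subseteq> A \<Longrightarrow> sum f G - s \<in> I"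
proof -
  obtain F where F: "finite F" "F \<subseteq> A"
    and G: "\<And>G. finite G \<Longrightarrow> F \<subseteq> G \<Longrightarrow> G \<subseteq> A \<Longrightarrow> sum f G - s \<in> I"
    using assms unfolding has_formal_sum_def eventually_finite_subsets_at_top by meson
  have "f a \<in> I" if "a \<in> A - F" for a
  proof -
    have "sum f (insert a F) - s - (sum f F - s) \<in> I"
      using F that by (intro ideal_diff[OF assms(2)] G) auto
    then show ?thesis using F that by simp
  qed
  with F G that show thesis by blast
qed

text \<open>Terms outside \<open>F\<close> change partial sums only by elements of \<open>I\<close>,
  so one good finite set per ideal is enough. With \<open>has_formal_sumE\<close> this replaces
  filter arguments below.\<close>

lemma has_formal_sumI:
  assumes "\<And>I. I \<in> \<I> \<Longrightarrow> \<exists>F. finite F \<and> F \<subseteq> A \<and> sum f F - s \<in> I \<and> (\<forall>a\<in>A - F. f a \<in> I)"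
  shows "has_formal_sum \<I> f A s"
  unfolding has_formal_sum_def eventually_finite_subsets_at_top
proof
  fix I assume I: "I \<in> \<I>"
  then obtain F where F: "finite F" "F \<subseteq> A" "sum f F - s \<in> I" "\<forall>a\<in>A - F. f a \<in> I"
    using assms by blast
  have "sum f G - s \<in> I" if G: "finite G" "F \<subseteq> G" "G \<subseteq> A" for G
  proof -
    have "sum f G - s = (sum f F - s) + sum f (G - F)"
      using sum.subset_diff[OF G(2,1), of f] by simp
    also have "\<dots> \<in> I"
      using F G by (intro ideal_add ideal_sum I) auto
    finally show ?thesis .
  qed
  then show "\<exists>F. finite F \<and> F \<subseteq> A \<and> (\<forall>G. finite G \<and> F \<subseteq> G \<and> G \<subseteq> A \<longrightarrow> sum f G - s \<in> I)"
    using F by blast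
qed

lemma has_formal_sum_closed:
  assumes "has_formal_sum \<I> f A s" "\<And>a. a \<in> A \<Longrightarrow> f a \<in> R"
  shows "s \<in> R"
proof -
  obtain I where I: "I \<in> \<I>" using ideals_nonempty by blast
  obtain F where F: "F \<subseteq> A" "sum f F - s \<in> I"
    using has_formal_sumE[OF assms(1) I] by metis
  have "sum f F \<in> R" using F assms(2) by (intro sum_closed) auto
  moreover have "sum f F - s \<in> R" using F I ideal_subset by blast
  ultimately have "sum f F - (sum f F - s) \<in> R" by (rule diff_closed)
  then show ?thesis by simp
qed

lemma has_formal_sum_times:
  assumes f: "has_formal_sum \<I> f A s" "\<And>a. a \<in> A \<Longrightarrow> f a \<in> R"
    and g: "has_formal_sum \<I> g B t" "\<And>b. b \<in> B \<Longrightarrow> g b \<in> R"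
  shows "has_formal_sum \<I> (\<lambda>(a, b). f a * g b) (A \<times> B) (s * t)"
proof (rule has_formal_sumI)
  fix I assume I: "I \<in> \<I>"
  obtain F where F: "finite F" "F \<subseteq> A" "sum f F - s \<in> I" "\<And>a. a \<in> A - F \<Longrightarrow> f a \<in> I"
    using has_formal_sumE[OF f(1) I] by metis
  obtain G where G: "finite G" "G \<subseteq> B" "sum g G - t \<in> I" "\<And>b. b \<in> B - G \<Longrightarrow> g b \<in> I"
    using has_formal_sumE[OF g(1) I] by metis
  \<comment> \<open>The error is split so that each summand is an element of \<open>R\<close> times
    an element of \<open>I\<close>; this uses that the limit \<open>s\<close> itself lies in
    \<open>R\<close>.\<close>
  have "(\<Sum>(a, b)\<in>F \<times> G. f a * g b) - s * t = sum g G * (sum f F - s) + s * (sum g G - t)"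
    by (simp add: sum.cartesian_product[symmetric] sum_product[symmetric] algebra_simps)
  also have "\<dots> \<in> I"
    using F G g(2) has_formal_sum_closed[OF f]
    by (intro ideal_add ideal_mult I sum_closed) auto
  finally have "(\<Sum>(a, b)\<in>F \<times> G. f a * g b) - s * t \<in> I" .
  \<comment> \<open>Outside the rectangle \<open>F \<times> G\<close> at least one factor lies in
    \<open>I\<close>, while the other lies in \<open>R\<close>.\<close>
  moreover have "f a * g b \<in> I" if "(a, b) \<in> A \<times> B - F \<times> G" for a b
    using that F(4)[of a] G(4)[of b] f(2)[of a] g(2)[of b]
      ideal_mult[OF I, of "f a" "g b"] ideal_mult[OF I, of "g b" "f a"]
    by (auto simp: mult.commute)
  ultimately show "\<exists>H. finite H \<and> H \<subseteq> A \<times> B \<and> (\<Sum>(a, b)\<in>H. f a * g b) - s * t \<in> I \<and>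
      (\<forall>p\<in>A \<times> B - H. (case p of (a, b) \<Rightarrow> f a * g b) \<in> I)"
    using F(1,2) G(1,2) by (intro exI[of _ "F \<times> G"]) auto
qed

lemma has_formal_sum_cmult:
  assumes "has_formal_sum \<I> f A s" "c \<in> R"
  shows "has_formal_sum \<I> (\<lambda>a. c * f a) A (c * s)"
proof (rule has_formal_sumI)
  fix I assume I: "I \<in> \<I>"
  obtain F where F: "finite F" "F \<subseteq> A" "sum f F - s \<in> I" "\<And>a. a \<in> A - F \<Longrightarrow> f a \<in> I"
    using has_formal_sumE[OF assms(1) I] by metis
  have "(\<Sum>a\<in>F. c * f a) - c * s = c * (sum f F - s)"
    by (simp add: sum_distrib_left algebra_simps)
  then show "\<exists>F. finite F \<and> F \<subseteq> A \<and> (\<Sum>a\<in>F. c * f a) - c * s \<in> I \<and> (\<forall>a\<in>A - F. c * f a \<in> I)"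
    using F ideal_mult[OF I assms(2)] by (intro exI[of _ F]) auto
qed

lemma has_formal_sum_Sigma_finite:
  assumes "finite K" "\<And>k. k \<in> K \<Longrightarrow> has_formal_sum \<I> (\<lambda>a. f (k, a)) (A k) (s k)"
  shows "has_formal_sum \<I> f (Sigma K A) (sum s K)"
proof (rule has_formal_sumI)
  fix I assume I: "I \<in> \<I>"
  have "\<forall>k\<in>K. \<exists>F. finite F \<and> F \<subseteq> A k \<and> (\<Sum>a\<in>F. f (k, a)) - s k \<in> I \<and> (\<forall>a\<in>A k - F. f (k, a) \<in> I)"
    using has_formal_sumE[OF assms(2) I] by metis
  then obtain F where F: "\<And>k. k \<in> K \<Longrightarrow> finite (F k)" "\<And>k. k \<in> K \<Longrightarrow> F k \<subseteq> A k"
      "\<And>k. k \<in> K \<Longrightarrow> (\<Sum>a\<in>F k. f (k, a)) - s k \<in> I"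
      "\<And>k a. k \<in> K \<Longrightarrow> a \<in> A k - F k \<Longrightarrow> f (k, a) \<in> I"
    unfolding bchoice_iff by blast
  have "sum f (Sigma K F) - sum s K = (\<Sum>k\<in>K. (\<Sum>a\<in>F k. f (k, a)) - s k)"
    using assms(1) F(1) by (simp add: sum.Sigma sum_subtractf)
  also have "\<dots> \<in> I" using F(3) by (intro ideal_sum I)
  finally show "\<exists>H. finite H \<and> H \<subseteq> Sigma K A \<and> sum f H - sum s K \<in> I \<and>
      (\<forall>a\<in>Sigma K A - H. f a \<in> I)"
    using assms(1) F(1,2,4) by (intro exI[of _ "Sigma K F"]) (auto; blast)
qed

lemma has_formal_sum_reindex:
  assumes "inj_on g A"
  shows "has_formal_sum \<I> f (g ` A) s \<longleftrightarrow> has_formal_sum \<I> (f \<circ> g) A s"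
  unfolding has_formal_sum_def
  by (simp add: filtermap_image_finite_subsets_at_top[OF assms, symmetric] eventually_filtermap
      eventually_finite_subsets_at_top)
     (use assms in \<open>auto simp: sum.reindex inj_on_subset\<close>)

text \<open>
  \<open>R\<close> need not be complete, so the two halves need not be summable separately, and \<open>s = - s\<close>
  does not suffice in characteristic 2; hence the cancellation on finite sets.
\<close>

lemma has_formal_sum_cancel:
  assumes sum: "has_formal_sum \<I> f T s"
    and bij: "bij_betw \<phi> {t \<in> T. P t} {t \<in> T. \<not> P t}"
    and neg: "\<And>t. t \<in> T \<Longrightarrow> P t \<Longrightarrow> f (\<phi> t) = - f t"
  shows "s = 0"
proof -
  have "- s \<in> I" if I: "I \<in> \<I>" for I
  proof -
    obtain F where F: "finite F" "F \<subseteq> T"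
      and sumI: "\<And>G. finite G \<Longrightarrow> F \<subseteq> G \<Longrightarrow> G \<subseteq> T \<Longrightarrow> sum f G - s \<in> I"
      using has_formal_sumE[OF sum I] by metis
    \<comment> \<open>The union of \<open>H\<close> and its image is the finite set obtained from
      \<open>F\<close> by completing every pair that \<open>F\<close> meets. Its sum vanishes, and
      being beyond \<open>F\<close> it is congruent to \<open>s\<close> modulo
      \<open>I\<close>.\<close>
    define H where "H = {t \<in> T. P t \<and> (t \<in> F \<or> \<phi> t \<in> F)}"
    have inj: "inj_on \<phi> {t \<in> T. P t}" using bij by (rule bij_betw_imp_inj_on)
    have "finite ({t \<in> T. P t} \<inter> \<phi> -` F)"
      using finite_vimage_IntI[OF F(1) inj] by (simp add: Int_commute)
    then have H: "finite H"
      by (rule finite_subset[rotated, OF finite_UnI[OF F(1)]]) (auto simp: H_def)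
    have \<phi>: "\<phi> t \<in> T \<and> \<not> P (\<phi> t)" if "t \<in> H" for t
      using bij_betwE[OF bij] that by (auto simp: H_def)
    have "sum f (H \<union> \<phi> ` H) = sum f H + sum f (\<phi> ` H)"
      using H \<phi> by (intro sum.union_disjoint) (auto simp: H_def)
    also have "sum f (\<phi> ` H) = sum (f \<circ> \<phi>) H"
      by (intro sum.reindex inj_on_subset[OF inj]) (auto simp: H_def)
    also have "\<dots> = - sum f H"
      unfolding sum_negf[symmetric] using neg by (intro sum.cong) (auto simp: H_def)
    finally have "sum f (H \<union> \<phi> ` H) = 0" by simp
    moreover have "F \<subseteq> H \<union> \<phi> ` H"
    proof
      fix t assume t: "t \<in> F"
      show "t \<in> H \<union> \<phi> ` H"
      proof (cases "P t")
        case True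
        then show ?thesis using t F by (auto simp: H_def)
      next
        case False
        then have "t \<in> \<phi> ` {t \<in> T. P t}"
          using t F bij_betw_imp_surj_on[OF bij] by auto
        then show ?thesis using t by (auto simp: H_def)
      qed
    qed
    ultimately show ?thesis
      using sumI[of "H \<union> \<phi> ` H"] H \<phi> by (auto simp: H_def)
  qed
  then have "- s \<in> \<Inter>\<I>" by blast
  then show ?thesis using separated by auto
qed

end

subsection \<open>Triangular matrices and polynomial sequences\<close>

text \<open>A left and a right inverse of \<open>B\<close> agree by associativity, with the two sums
  exchanged over the triangle \<open>m \<le> k \<le> l \<le> n\<close>. Triangularity is built into
  the index ranges.\<close>

lemma triangular_inverse_unique:
  fixes A B C :: "nat \<Rightarrow> nat \<Rightarrow> 'a::comm_ring_1"
  assumes AB: "\<And>n m. m \<le> n \<Longrightarrow> (\<Sum>k=m..n. A n k * B k m) = (if n = m then 1 else 0)"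
    and BC: "\<And>n m. m \<le> n \<Longrightarrow> (\<Sum>k=m..n. B n k * C k m) = (if n = m then 1 else 0)"
    and "m \<le> n"
  shows "A n m = C n m"
proof -
  have "A n m = (\<Sum>l=m..n. A n l * (if l = m then 1 else 0))"
    using \<open>m \<le> n\<close> by (simp add: if_distrib sum.delta' cong: if_cong)
  also have "\<dots> = (\<Sum>l=m..n. \<Sum>k=m..l. A n l * B l k * C k m)"
    by (intro sum.cong) (simp_all add: BC[symmetric] sum_distrib_left mult.assoc)
  also have "\<dots> = (\<Sum>k=m..n. \<Sum>l=k..n. A n l * B l k * C k m)"
    unfolding sum.Sigma[OF finite_atLeastAtMost ballI[OF finite_atLeastAtMost]]
    by (intro sum.reindex_bij_witness[of _ prod.swap prod.swap]) auto
  also have "\<dots> = (\<Sum>k=m..n. (if n = k then 1 else 0) * C k m)"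
    by (intro sum.cong) (simp_all add: AB[symmetric] sum_distrib_right)
  also have "\<dots> = C n m"
    using \<open>m \<le> n\<close> by (simp add: if_distrib[of "\<lambda>c. c * _"] cong: if_cong)
  finally show ?thesis .
qed

lemma smult_sum_right: "smult c (sum f A) = (\<Sum>a\<in>A. smult c (f a))"
  by (induction A rule: infinite_finite_induct) (simp_all add: smult_add_right)

text \<open>Only the last term reaches the top degree, so its coefficient can be compared and the
  term cancelled; induction handles the rest.\<close>

lemma polynomial_sequence_coeff_eq:
  assumes p: "polynomial_sequence p"
    and eq: "(\<Sum>k=0..n. smult (a k) (p k)) = (\<Sum>k=0..n. smult (b k) (p k))"
    and "k \<le> n"
  shows "a k = b k"
  using eq \<open>k \<le> n\<close>
proof (induction n)
  case 0
  then have "smult (a 0 - b 0) (p 0) = 0" by (simp add: smult_diff_left)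
  then show ?case using p 0 by (auto simp: polynomial_sequence_def)
next
  case (Suc n)
  have deg: "degree (p k) = k" "p k \<noteq> 0" for k
    using p by (auto simp: polynomial_sequence_def)
  have c: "coeff (\<Sum>k=0..Suc n. smult (c k) (p k)) (Suc n) = c (Suc n) * lead_coeff (p (Suc n))" for c
    by (simp add: coeff_sum deg coeff_eq_0)
  have "lead_coeff (p (Suc n)) \<noteq> 0" using deg(2)[of "Suc n"] by simp
  moreover have "a (Suc n) * lead_coeff (p (Suc n)) = b (Suc n) * lead_coeff (p (Suc n))"
    using arg_cong[OF Suc.prems(1), of "\<lambda>r. coeff r (Suc n)"] unfolding c .
  ultimately have "a (Suc n) = b (Suc n)" by (metis mult_right_cancel)
  then show ?case
    using Suc by (cases "k = Suc n") auto
qed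

text \<open>Substituting the expansions of the \<open>q k\<close> into that of \<open>p n\<close>
  expands \<open>p n\<close> in the sequence \<open>p\<close> itself, and uniqueness of such an
  expansion forces the identity matrix.\<close>

lemma mixed_coefficients_moments_inverse:
  assumes p: "polynomial_sequence p"
    and \<sigma>: "mixed_moments p q \<sigma>" and \<nu>: "mixed_coefficients p q \<nu>" and "m \<le> n"
  shows "(\<Sum>k=m..n. \<nu> n k * \<sigma> k m) = (if n = m then 1 else 0)"
proof -
  have "(\<Sum>m=0..n. smult (\<Sum>k=m..n. \<nu> n k * \<sigma> k m) (p m)) =
      (\<Sum>m=0..n. \<Sum>k=m..n. smult (\<nu> n k * \<sigma> k m) (p m))"
    by (simp add: smult_sum)
  also have "\<dots> = (\<Sum>k=0..n. \<Sum>m=0..k. smult (\<nu> n k * \<sigma> k m) (p m))"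
    unfolding sum.Sigma[OF finite_atLeastAtMost ballI[OF finite_atLeastAtMost]]
    by (intro sum.reindex_bij_witness[of _ prod.swap prod.swap]) auto
  also have "\<dots> = (\<Sum>k=0..n. smult (\<nu> n k) (q k))"
  proof (intro sum.cong refl)
    fix k
    have q: "q k = (\<Sum>m=0..k. smult (\<sigma> k m) (p m))"
      using \<sigma> by (simp add: mixed_moments_def)
    show "(\<Sum>m=0..k. smult (\<nu> n k * \<sigma> k m) (p m)) = smult (\<nu> n k) (q k)"
      unfolding q by (simp add: smult_sum_right)
  qed
  also have "\<dots> = p n" using \<nu> by (simp add: mixed_coefficients_def)
  also have "\<dots> = (\<Sum>m=0..n. smult (if n = m then 1 else 0) (p m))"
    by (simp add: if_distrib[of "\<lambda>c. smult c _"] cong: if_cong)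
  finally show ?thesis
    by (rule polynomial_sequence_coeff_eq[OF p, where a = "\<lambda>m. \<Sum>k=m..n. \<nu> n k * \<sigma> k m"])
      (rule \<open>m \<le> n\<close>)
qed

subsection \<open>Paths determined by their jumps\<close>

text \<open>A common model for both kinds of path, with levels counted from the starting column. The
  label \<open>c\<close> of a jump is the row at the west end of the east step: this is where an
  \<open>NE\<close> path leaves a level, and where an \<open>SE\<close> path, read backwards, enters
  the next one. Injectivity recovers the label from the row of departure.\<close>

locale level_graph =
  fixes src dst :: "nat \<Rightarrow> nat \<Rightarrow> nat"
  assumes inj_src: "inj (src a)"
begin

definition up :: "nat \<times> nat \<Rightarrow> nat \<times> nat \<Rightarrow> bool" where
  "up x y \<longleftrightarrow> y = (fst x, Suc (snd x))"

definition jump :: "nat \<times> nat \<Rightarrow> nat \<times> nat \<Rightarrow> bool" where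
  "jump x y \<longleftrightarrow> (\<exists>a c. x = (a, src a c) \<and> y = (Suc a, dst a c))"

text \<open>Constancy of the level stands for convergence to the top: once the level is constant,
  every step is \<open>up\<close> and the row grows without bound.\<close>

definition paths :: "nat \<Rightarrow> (nat \<Rightarrow> nat \<times> nat) set" where
  "paths L = {u. u 0 = (0, 0) \<and> (\<forall>m. up (u m) (u (Suc m)) \<or> jump (u m) (u (Suc m))) \<and>
     (\<forall>\<^sub>F m in sequentially. fst (u m) = L)}"

definition jumps :: "(nat \<Rightarrow> nat \<times> nat) \<Rightarrow> (nat \<times> nat) set" where
  "jumps u = {(a, c). \<exists>m. u m = (a, src a c) \<and> u (Suc m) = (Suc a, dst a c)}"

definition compatible :: "nat \<Rightarrow> (nat \<Rightarrow> nat) \<Rightarrow> bool" where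
  "compatible L x \<longleftrightarrow> (\<forall>a. Suc a < L \<longrightarrow> dst a (x a) \<le> src (Suc a) (x (Suc a)))"

lemma paths_step: "u \<in> paths L \<Longrightarrow> up (u m) (u (Suc m)) \<or> jump (u m) (u (Suc m))"
  by (simp add: paths_def)

lemma paths_eventually: "u \<in> paths L \<Longrightarrow> \<exists>M. \<forall>m\<ge>M. fst (u m) = L"
  by (simp add: paths_def eventually_sequentially)

lemma paths_mono:
  assumes "u \<in> paths L" "m \<le> m'"
  shows "fst (u m) \<le> fst (u m')"
  using assms(2)
proof (rule lift_Suc_mono_le[rotated])
  show "fst (u m) \<le> fst (u (Suc m))" for m
    using paths_step[OF assms(1), of m] by (auto simp: up_def jump_def)
qed

lemma paths_level_le:
  assumes "u \<in> paths L"
  shows "fst (u m) \<le> L"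
proof -
  obtain M where "\<forall>m\<ge>M. fst (u m) = L" using paths_eventually[OF assms] by blast
  then show ?thesis using paths_mono[OF assms, of m "max m M"] by auto
qed

text \<open>Every jump raises the level for good, so between two times at the same level all steps
  are \<open>up\<close>.\<close>

lemma paths_same_level:
  assumes u: "u \<in> paths L" and "m \<le> m'" "fst (u m') = fst (u m)"
  shows "snd (u m') = snd (u m) + (m' - m)"
  using assms(2,3)
proof (induction m' rule: dec_induct)
  case (step m')
  have level: "fst (u m') = fst (u m)"
    using paths_mono[OF u step(1)] paths_mono[OF u, of m' "Suc m'"] step.prems by linarith
  then have "up (u m') (u (Suc m'))"
    using step.prems paths_step[OF u, of m'] by (auto simp: jump_def)
  then show ?case
    using step.IH[OF level] step.hyps by (simp add: up_def)
qed simp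

lemma paths_inj:
  assumes u: "u \<in> paths L" and "u m = u m'"
  shows "m = m'"
proof (cases "m \<le> m'")
  case True
  then have "snd (u m') = snd (u m) + (m' - m)"
    using assms(2) by (intro paths_same_level[OF u]) simp_all
  then show ?thesis using True assms(2) by simp
next
  case False
  then have "snd (u m) = snd (u m') + (m - m')"
    using assms(2) by (intro paths_same_level[OF u]) simp_all
  then show ?thesis using False assms(2) by simp
qed

lemma paths_mono_strict_level:
  assumes u: "u \<in> paths L" and "fst (u m) < fst (u m')"
  shows "m < m'"
  using paths_mono[OF u, of m' m] assms(2) by (meson not_le)

text \<open>By induction on time. A path visits each point at most once, so its jump set decides
  whether and where it jumps from the current point.\<close>

lemma inj_on_jumps: "inj_on jumps (paths L)"
proof (rule inj_onI)
  fix u u' assume u: "u \<in> paths L" and u': "u' \<in> paths L" and eq: "jumps u = jumps u'"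
  have transfer: "v' (Suc m) = v (Suc m)"
    if v': "v' \<in> paths L" and j: "jumps v = jumps v'" and m: "v m = v' m" "jump (v m) (v (Suc m))"
    for v v' m
  proof -
    obtain a c where ac: "v m = (a, src a c)" "v (Suc m) = (Suc a, dst a c)"
      using m(2) by (auto simp: jump_def)
    then have "(a, c) \<in> jumps v" by (auto simp: jumps_def)
    then have "(a, c) \<in> jumps v'" by (simp add: j)
    then obtain m' where m': "v' m' = (a, src a c)" "v' (Suc m') = (Suc a, dst a c)"
      by (auto simp: jumps_def)
    then have "m' = m" using paths_inj[OF v', of m' m] ac m by simp
    then show ?thesis using m' ac by simp
  qed
  have "u m = u' m" for m
  proof (induction m)
    case 0
    then show ?case using u u' by (simp add: paths_def)
  next
    case (Suc m)
    then show ?case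
      using transfer[OF u' eq, of m] transfer[OF u eq[symmetric], of m]
        paths_step[OF u, of m] paths_step[OF u', of m] by (auto simp: up_def)
  qed
  then show "u = u'" by blast
qed

lemma paths_crosses:
  assumes u: "u \<in> paths L" and "a < L"
  obtains m c where "u m = (a, src a c)" "u (Suc m) = (Suc a, dst a c)"
proof -
  obtain M where "fst (u M) = L" using paths_eventually[OF u] by blast
  then have ex: "\<exists>m. a < fst (u m)" using \<open>a < L\<close> by blast
  \<comment> \<open>The step arriving at the first time beyond level \<open>a\<close> must be the
    jump out of level \<open>a\<close>.\<close>
  define m where "m = (LEAST m. a < fst (u m))"
  have m: "a < fst (u m)" unfolding m_def using ex by (rule LeastI_ex)
  then obtain m0 where m0: "m = Suc m0"
    using u by (cases m) (auto simp: paths_def)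
  have "\<not> a < fst (u m0)"
    using not_less_Least[of m0 "\<lambda>m. a < fst (u m)"] m0 by (simp add: m_def)
  then show thesis
    using paths_step[OF u, of m0] m m0 that[of m0] by (auto simp: up_def jump_def less_Suc_eq)
qed

text \<open>Each level below \<open>L\<close> is left by exactly one jump, which gives
  \<open>x\<close>; compatibility holds because a path can only climb between its arrival in a level
  and its departure.\<close>

lemma jumps_path:
  assumes u: "u \<in> paths L"
  obtains x where "compatible L x" "jumps u = (\<lambda>a. (a, x a)) ` {..<L}"
proof -
  have "\<forall>a. a < L \<longrightarrow> (\<exists>c m. u m = (a, src a c) \<and> u (Suc m) = (Suc a, dst a c))"
    using paths_crosses[OF u] by metis
  then obtain x m where xm: "\<And>a. a < L \<Longrightarrow> u (m a) = (a, src a (x a))"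
      "\<And>a. a < L \<Longrightarrow> u (Suc (m a)) = (Suc a, dst a (x a))"
    by metis
  have "compatible L x"
    unfolding compatible_def
  proof (intro allI impI)
    fix a assume a: "Suc a < L"
    have "m a < m (Suc a)"
      using paths_mono_strict_level[OF u, of "m a" "m (Suc a)"] xm a by simp
    then show "dst a (x a) \<le> src (Suc a) (x (Suc a))"
      using paths_same_level[OF u, of "Suc (m a)" "m (Suc a)"] xm a by simp
  qed
  moreover have "c = x a \<and> a < L" if m': "u m' = (a, src a c)" "u (Suc m') = (Suc a, dst a c)" for a c m'
  proof -
    have a: "a < L" using paths_level_le[OF u, of "Suc m'"] m' by simp
    \<comment> \<open>If two jumps left level \<open>a\<close> at different times, the earlier one
      would already have raised the level when the later one starts.\<close>
    have "\<not> m' < m a" "\<not> m a < m'"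
      using paths_mono[OF u, of "Suc m'" "m a"] paths_mono[OF u, of "Suc (m a)" "m'"] m' xm a
      by (auto simp: Suc_le_eq)
    then have "m' = m a" by simp
    then have "src a (x a) = src a c" using m' xm a by auto
    then show ?thesis using injD[OF inj_src] a by metis
  qed
  then have "p \<in> jumps u \<longleftrightarrow> p \<in> (\<lambda>a. (a, x a)) ` {..<L}" for p
    unfolding jumps_def using xm by (cases p) blast
  then have "jumps u = (\<lambda>a. (a, x a)) ` {..<L}" by blast
  ultimately show thesis by (rule that)
qed

text \<open>The greedy candidate for a path with prescribed jumps. If it entered a level above the
  departure row, the equality test would never succeed and it would climb there forever;
  compatibility excludes this.\<close>

fun walk :: "nat \<Rightarrow> (nat \<Rightarrow> nat) \<Rightarrow> nat \<Rightarrow> nat \<times> nat" where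
  "walk L x 0 = (0, 0)"
| "walk L x (Suc m) = (let (a, r) = walk L x m in
     if a < L \<and> r = src a (x a) then (Suc a, dst a (x a)) else (a, Suc r))"

lemma walk_climbs:
  assumes "walk L x m = (a, r)" "a < L" "r \<le> src a (x a)"
  shows "\<exists>m. walk L x m = (a, src a (x a))"
  using assms
proof (induction "src a (x a) - r" arbitrary: m r)
  case 0
  then show ?case by auto
next
  case (Suc d)
  then show ?case by (intro Suc(1)[of "Suc r" "Suc m"]) auto
qed

lemma walk_crosses:
  assumes "compatible L x" "a < L"
  shows "\<exists>m. walk L x m = (a, src a (x a))"
  using assms(2)
proof (induction a)
  case 0
  then show ?case using walk_climbs[of L x 0 0 0] by simp
next
  case (Suc a)
  then obtain m where "walk L x m = (a, src a (x a))" by auto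
  then have "walk L x (Suc m) = (Suc a, dst a (x a))" using Suc.prems by simp
  \<comment> \<open>Compatibility puts the arrival row at or below the next departure row, as
    \<open>walk_climbs\<close> requires.\<close>
  then show ?case
    using walk_climbs[of L x "Suc m"] Suc.prems assms(1) by (simp add: compatible_def)
qed

lemma walk_reaches:
  assumes "compatible L x"
  shows "\<exists>M. \<forall>m\<ge>M. fst (walk L x m) = L"
proof -
  have "\<exists>M. fst (walk L x M) = L"
  proof (cases L)
    case (Suc a)
    then obtain m where "walk L x m = (a, src a (x a))"
      using walk_crosses[OF assms, of a] by auto
    then have "walk L x (Suc m) = (L, dst a (x a))" using Suc by simp
    then show ?thesis by (metis fst_conv)
  qed (auto intro: exI[of _ 0])
  then obtain M where M: "fst (walk L x M) = L" by blast
  have "fst (walk L x m) = L" if "M \<le> m" for m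
    using that by (induction m rule: dec_induct) (auto simp: M split_beta)
  then show ?thesis by blast
qed

lemma walk_paths:
  assumes "compatible L x"
  shows "walk L x \<in> paths L" "jumps (walk L x) = (\<lambda>a. (a, x a)) ` {..<L}"
proof -
  show "walk L x \<in> paths L"
    using walk_reaches[OF assms]
    by (auto simp: paths_def eventually_sequentially up_def jump_def split_beta prod_eq_iff)
  show "jumps (walk L x) = (\<lambda>a. (a, x a)) ` {..<L}"
  proof (intro equalityI subsetI)
    fix p assume "p \<in> jumps (walk L x)"
    then obtain a c m where p: "p = (a, c)" "walk L x m = (a, src a c)"
      "walk L x (Suc m) = (Suc a, dst a c)"
      by (auto simp: jumps_def)
    then show "p \<in> (\<lambda>a. (a, x a)) ` {..<L}"
      using injD[OF inj_src] by (auto split: if_splits)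
  next
    fix p assume "p \<in> (\<lambda>a. (a, x a)) ` {..<L}"
    then obtain a where a: "a < L" "p = (a, x a)" by auto
    then obtain m where "walk L x m = (a, src a (x a))" using walk_crosses[OF assms] by blast
    then show "p \<in> jumps (walk L x)" using a by (auto simp: jumps_def intro!: exI[of _ m])
  qed
qed

text \<open>Two jumps follow each other directly exactly when the first lands on the departure row
  of the second. Forbidding this turns the weak inequalities of \<open>compatible\<close> into
  strict ones.\<close>

lemma consecutive_jumps_iff:
  assumes u: "u \<in> paths L" and x: "jumps u = (\<lambda>a. (a, x a)) ` {..<L}"
  shows "(\<exists>m. jump (u m) (u (Suc m)) \<and> jump (u (Suc m)) (u (Suc (Suc m)))) \<longleftrightarrow>
    (\<exists>a. Suc a < L \<and> dst a (x a) = src (Suc a) (x (Suc a)))"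
proof
  assume "\<exists>m. jump (u m) (u (Suc m)) \<and> jump (u (Suc m)) (u (Suc (Suc m)))"
  then obtain m a c c' where m: "u m = (a, src a c)" "u (Suc m) = (Suc a, dst a c)"
      "u (Suc m) = (Suc a, src (Suc a) c')" "u (Suc (Suc m)) = (Suc (Suc a), dst (Suc a) c')"
    by (auto simp: jump_def)
  then have "(a, c) \<in> jumps u" "(Suc a, c') \<in> jumps u" unfolding jumps_def by blast+
  then show "\<exists>a. Suc a < L \<and> dst a (x a) = src (Suc a) (x (Suc a))"
    using m unfolding x by auto
next
  assume "\<exists>a. Suc a < L \<and> dst a (x a) = src (Suc a) (x (Suc a))"
  then obtain a where a: "Suc a < L" "dst a (x a) = src (Suc a) (x (Suc a))" by blast
  then have "(a, x a) \<in> jumps u" "(Suc a, x (Suc a)) \<in> jumps u" by (auto simp: x)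
  then obtain m m' where m: "u m = (a, src a (x a))" "u (Suc m) = (Suc a, dst a (x a))"
      "u m' = (Suc a, src (Suc a) (x (Suc a)))" "u (Suc m') = (Suc (Suc a), dst (Suc a) (x (Suc a)))"
    unfolding jumps_def by auto
  then have "m' = Suc m" using a by (intro paths_inj[OF u]) simp
  then show "\<exists>m. jump (u m) (u (Suc m)) \<and> jump (u (Suc m)) (u (Suc (Suc m)))"
    using m unfolding jump_def by blast
qed

end

subsection \<open>Paths in the lecture hall graph\<close>

definition lh_point :: "nat \<Rightarrow> nat \<Rightarrow> nat \<times> real" where
  "lh_point i r = (i, real r / real (Suc i))"

text \<open>In column \<open>i\<close> the vertex with label \<open>t\<close>, \<open>j\<close> has
  row \<open>t * Suc i + j\<close>; its east neighbour has row \<open>t * Suc (Suc i) + j\<close>,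
  which is larger by \<open>t\<close>, the quotient of the row by \<open>Suc i\<close>.\<close>

definition east_row :: "nat \<Rightarrow> nat \<Rightarrow> nat" where
  "east_row i r = r + r div Suc i"

lemma lh_point_eq_iff [simp]: "lh_point i r = lh_point i' r' \<longleftrightarrow> i = i' \<and> r = r'"
  by (auto simp: lh_point_def)

lemma lh_vertex_eq_lh_point: "lh_vertex t i j = lh_point i (t * Suc i + j)"
  by (simp add: lh_vertex_def lh_point_def field_simps)

lemma lh_vertex_div_mod: "lh_vertex (r div Suc i) i (r mod Suc i) = lh_point i r"
  by (simp only: lh_vertex_eq_lh_point div_mult_mod_eq)

lemma lh_vertex_div_mod_east:
  "lh_vertex (r div Suc i) (i + 1) (r mod Suc i) = lh_point (Suc i) (east_row i r)"
proof -
  have "r div Suc i * Suc (Suc i) + r mod Suc i = r div Suc i + (r div Suc i * Suc i + r mod Suc i)"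
    by simp
  also have "\<dots> = east_row i r"
    by (simp only: div_mult_mod_eq east_row_def add.commute[of r])
  finally show ?thesis by (simp only: lh_vertex_eq_lh_point Suc_eq_plus1)
qed

lemma inj_east_row: "inj (east_row i)"
proof -
  have "strict_mono (east_row i)"
    by (rule strict_monoI) (simp add: east_row_def add_less_le_mono div_le_mono)
  then show ?thesis by (rule strict_mono_imp_inj_on)
qed

lemma label_cases:
  assumes "j \<le> i"
  obtains r where "t = r div Suc i" "j = r mod Suc i"
proof (rule that[of "t * Suc i + j"])
  show "t = (t * Suc i + j) div Suc i" using assms by (simp only: div_mult_self3) simp
  show "j = (t * Suc i + j) mod Suc i" using assms by (simp only: mod_mult_self3) simp
qed

lemma east_step_iff:
  "east_step u v \<longleftrightarrow> (\<exists>i r. u = lh_point i r \<and> v = lh_point (Suc i) (east_row i r))"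
proof
  assume "east_step u v"
  then obtain t i j where "j \<le> i" "u = lh_vertex t i j" "v = lh_vertex t (i + 1) j"
    by (auto simp: east_step_def)
  then show "\<exists>i r. u = lh_point i r \<and> v = lh_point (Suc i) (east_row i r)"
    by (metis label_cases lh_vertex_div_mod lh_vertex_div_mod_east)
next
  assume "\<exists>i r. u = lh_point i r \<and> v = lh_point (Suc i) (east_row i r)"
  then obtain i r where "u = lh_point i r" "v = lh_point (Suc i) (east_row i r)" by blast
  then show "east_step u v"
    unfolding east_step_def
    by (intro exI[of _ "r div Suc i"] exI[of _ i] exI[of _ "r mod Suc i"])
      (simp add: lh_vertex_div_mod lh_vertex_div_mod_east[simplified])
qed

text \<open>Numbering by rows absorbs the convention that \<open>j = i + 1\<close> in block
  \<open>t\<close> means \<open>j = 0\<close> in block \<open>t + 1\<close>.\<close>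

lemma north_step_iff:
  "north_step u v \<longleftrightarrow> (\<exists>i r. u = lh_point i r \<and> v = lh_point i (Suc r))"
proof
  assume "north_step u v"
  then show "\<exists>i r. u = lh_point i r \<and> v = lh_point i (Suc r)"
    unfolding north_step_def lh_vertex_eq_lh_point by (metis add.assoc Suc_eq_plus1)
next
  assume "\<exists>i r. u = lh_point i r \<and> v = lh_point i (Suc r)"
  then obtain i r where *: "u = lh_point i r" "v = lh_point i (Suc r)" by blast
  have "lh_vertex (r div Suc i) i (r mod Suc i + 1) = lh_point i (Suc r)"
    by (simp only: lh_vertex_eq_lh_point add.assoc[symmetric] div_mult_mod_eq Suc_eq_plus1)
  then show "north_step u v"
    unfolding north_step_def
    using * lh_vertex_div_mod[of r i] mod_less_divisor[of "Suc i" r]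
    by (intro exI[of _ "r div Suc i"] exI[of _ i] exI[of _ "r mod Suc i"]) simp
qed

lemma south_step_iff_north_step: "south_step u v \<longleftrightarrow> north_step v u"
  unfolding south_step_def north_step_def by blast

definition edge_weight :: "(nat \<Rightarrow> nat \<Rightarrow> nat \<Rightarrow> 'k::field) \<Rightarrow> nat \<times> nat \<Rightarrow> 'k" where
  "edge_weight w = (\<lambda>(i, r). w (r div Suc i) i (r mod Suc i))"

definition east_edges :: "((nat \<times> real) \<times> (nat \<times> real)) set \<Rightarrow> (nat \<times> nat) set" where
  "east_edges S = {(i, r). (lh_point i r, lh_point (Suc i) (east_row i r)) \<in> S}"

text \<open>Division with remainder by \<open>Suc i\<close> is the bijection between rows of column
  \<open>i\<close> and labels \<open>t\<close>, \<open>j\<close> with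
  \<open>j \<le> i\<close>.\<close>

lemma steps_weight_east_edges: "steps_weight w S = prod (edge_weight w) (east_edges S)"
  unfolding steps_weight_def
proof (rule prod.reindex_bij_witness
      [of _ "\<lambda>(i, r). (r div Suc i, i, r mod Suc i)" "\<lambda>(t, i, j). (i, t * Suc i + j)"])
  fix l assume "l \<in> {(t, i, j). j \<le> i \<and> (lh_vertex t i j, lh_vertex t (i + 1) j) \<in> S}"
  then obtain t i j where l: "l = (t, i, j)" "j \<le> i"
      "(lh_vertex t i j, lh_vertex t (i + 1) j) \<in> S" by auto
  obtain r where r: "t = r div Suc i" "j = r mod Suc i" using label_cases[OF l(2)] .
  have tr: "t * Suc i + j = r" unfolding r by (rule div_mult_mod_eq)
  show "(case case l of (t, i, j) \<Rightarrow> (i, t * Suc i + j) of (i, r) \<Rightarrow> (r div Suc i, i, r mod Suc i)) = l"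
    unfolding l(1) prod.case tr by (simp only: r)
  have "(lh_point i r, lh_point (Suc i) (east_row i r)) \<in> S"
    using l(3) unfolding r lh_vertex_div_mod lh_vertex_div_mod_east .
  then show "(case l of (t, i, j) \<Rightarrow> (i, t * Suc i + j)) \<in> east_edges S"
    unfolding l(1) prod.case tr by (simp add: east_edges_def)
  show "edge_weight w (case l of (t, i, j) \<Rightarrow> (i, t * Suc i + j)) = (case l of (t, i, j) \<Rightarrow> w t i j)"
    unfolding l(1) prod.case tr by (simp only: r edge_weight_def prod.case)
next
  fix e assume "e \<in> east_edges S"
  then obtain i r where e: "e = (i, r)" "(lh_point i r, lh_point (Suc i) (east_row i r)) \<in> S"
    by (auto simp: east_edges_def)
  show "(case case e of (i, r) \<Rightarrow> (r div Suc i, i, r mod Suc i) of (t, i, j) \<Rightarrow> (i, t * Suc i + j)) = e"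
    unfolding e(1) prod.case div_mult_mod_eq ..
  show "(case e of (i, r) \<Rightarrow> (r div Suc i, i, r mod Suc i)) \<in>
      {(t, i, j). j \<le> i \<and> (lh_vertex t i j, lh_vertex t (i + 1) j) \<in> S}"
    using e(2) mod_less_divisor[of "Suc i" r]
    unfolding e(1) prod.case mem_Collect_eq lh_vertex_div_mod lh_vertex_div_mod_east
    by (simp add: less_Suc_eq_le)
qed

text \<open>The column is a natural number, so its convergence means eventual constancy.\<close>

lemma tends_to_top_eventually:
  assumes "tends_to_top v k"
  shows "\<forall>\<^sub>F m in sequentially. fst (v m) = k"
proof -
  have "(\<lambda>m. fst (v m)) \<longlonglongrightarrow> k"
    using tendsto_fst[OF assms[unfolded tends_to_top_def]] by simp
  then show ?thesis by (simp add: tendsto_discrete)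
qed

lemma tends_to_topI:
  assumes "\<And>d. v (M + d) = lh_point k (r + d)"
  shows "tends_to_top v k"
proof -
  have "(\<lambda>d. (fst (v (d + M)), ereal (snd (v (d + M))))) \<longlonglongrightarrow> (k, \<infinity>)"
  proof (rule tendsto_Pair)
    show "(\<lambda>d. fst (v (d + M))) \<longlonglongrightarrow> k"
      using assms by (simp add: add.commute lh_point_def)
    have "filterlim (\<lambda>d. real (r + d) / real (Suc k)) at_top sequentially"
      by real_asymp
    then show "(\<lambda>d. ereal (snd (v (d + M)))) \<longlonglongrightarrow> \<infinity>"
      using assms by (simp add: add.commute lh_point_def tendsto_PInfty_eq_at_top)
  qed
  then show ?thesis unfolding tends_to_top_def by (rule LIMSEQ_offset)
qed

text \<open>Dependent choice lifts a vertex sequence \<open>v\<close> through the coordinates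
  \<open>f\<close> one step at a time. The invariant \<open>D\<close> confines the lift to a region
  where \<open>f\<close> is faithful.\<close>

lemma level_path_lift:
  assumes v0: "v 0 = f (0, 0)" "D (0, 0)"
    and step: "\<And>m x. D x \<Longrightarrow> v m = f x \<Longrightarrow> \<exists>y. D y \<and> v (Suc m) = f y \<and> S x y"
  obtains u where "u 0 = (0::nat, 0::nat)" "\<And>m. v m = f (u m)" "\<And>m. D (u m)" "\<And>m. S (u m) (u (Suc m))"
proof -
  have "\<exists>u. \<forall>m. (D (u m) \<and> v m = f (u m) \<and> (m = 0 \<longrightarrow> u m = (0, 0))) \<and> S (u m) (u (Suc m))"
    by (rule dependent_nat_choice) (use v0 step in auto)
  then show thesis using that by blast
qed

context level_graph
begin

lemma paths_tends_to_top:
  assumes u: "u \<in> paths L" and f: "\<And>r. f (L, r) = lh_point k r"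
  shows "tends_to_top (f \<circ> u) k"
proof -
  obtain M where M: "\<forall>m\<ge>M. fst (u m) = L" using paths_eventually[OF u] by blast
  have "u (M + d) = (L, snd (u M) + d)" for d
    using M paths_same_level[OF u, of M "M + d"] by (simp add: prod_eq_iff)
  then have "(f \<circ> u) (M + d) = lh_point k (snd (u M) + d)" for d by (simp add: f)
  then show ?thesis by (rule tends_to_topI)
qed

end

section \<open>Encoding paths by the rows of their east steps\<close>

definition SE_codes :: "nat \<Rightarrow> nat \<Rightarrow> (nat \<Rightarrow> nat) set" where
  "SE_codes k n = {z \<in> {k..<n} \<rightarrow>\<^sub>E UNIV.
     \<forall>i. k \<le> i \<and> Suc i < n \<longrightarrow> z (Suc i) \<le> east_row i (z i)}"

definition NE_codes :: "nat \<Rightarrow> nat \<Rightarrow> (nat \<Rightarrow> nat) set" where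
  "NE_codes k n = {z \<in> {k..<n} \<rightarrow>\<^sub>E UNIV.
     \<forall>i. k \<le> i \<and> Suc i < n \<longrightarrow> east_row i (z i) < z (Suc i)}"

text \<open>Paths and codes are compared through their sets of east edges: both determine such a set
  injectively, the same sets arise from both, and the weight is a product over the set.\<close>

definition code_edges :: "nat \<Rightarrow> nat \<Rightarrow> (nat \<Rightarrow> nat) \<Rightarrow> (nat \<times> nat) set" where
  "code_edges k n z = (\<lambda>i. (i, z i)) ` {k..<n}"

lemma inj_on_code_edges: "inj_on (code_edges k n) ({k..<n} \<rightarrow>\<^sub>E UNIV)"
proof (rule inj_onI, rule PiE_ext)
  fix y z i assume "code_edges k n y = code_edges k n z" "i \<in> {k..<n}"
  then have "(i, y i) \<in> code_edges k n z" unfolding code_edges_def by blast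
  then show "y i = z i" by (auto simp: code_edges_def)
qed

definition NE_edges :: "(nat \<Rightarrow> nat \<times> real) \<Rightarrow> (nat \<times> nat) set" where
  "NE_edges v = east_edges (range (\<lambda>m. (v m, v (m + 1))))"

definition SE_edges :: "(nat \<Rightarrow> nat \<times> real) \<Rightarrow> (nat \<times> nat) set" where
  "SE_edges v = east_edges (range (\<lambda>m. (v (m + 1), v m)))"

lemma in_NE_edges_iff:
  "(i, r) \<in> NE_edges v \<longleftrightarrow> (\<exists>m. v m = lh_point i r \<and> v (Suc m) = lh_point (Suc i) (east_row i r))"
  by (simp add: NE_edges_def east_edges_def image_iff eq_commute)

lemma in_SE_edges_iff:
  "(i, r) \<in> SE_edges v \<longleftrightarrow> (\<exists>m. v (Suc m) = lh_point i r \<and> v m = lh_point (Suc i) (east_row i r))"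
  by (simp add: SE_edges_def east_edges_def image_iff eq_commute)

context
  fixes k n :: nat
  assumes kn: "k \<le> n"
begin

section \<open>The \<open>NE\<close> paths, with level \<open>a\<close> in column
  \<open>k + a\<close>\<close>

interpretation NE: level_graph "\<lambda>a c. c" "\<lambda>a c. east_row (k + a) c"
  by unfold_locales (simp add: inj_on_def)

private definition NE_point :: "nat \<times> nat \<Rightarrow> nat \<times> real" where
  "NE_point x = lh_point (k + fst x) (snd x)"

private lemma NE_point_north: "north_step (NE_point x) (NE_point y) \<longleftrightarrow> NE.up x y"
  by (cases x; cases y) (auto simp: north_step_iff NE.up_def NE_point_def)

private lemma NE_point_east: "east_step (NE_point x) (NE_point y) \<longleftrightarrow> NE.jump x y"
  by (cases x; cases y) (auto simp: east_step_iff NE.jump_def NE_point_def)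

private lemma NE_star_paths_eq:
  "NE_star_paths k n = (\<circ>) NE_point ` {u \<in> NE.paths (n - k).
     \<not> (\<exists>m. NE.jump (u m) (u (Suc m)) \<and> NE.jump (u (Suc m)) (u (Suc (Suc m))))}"
  (is "_ = _ ` ?U")
proof (intro equalityI subsetI)
  fix v assume v: "v \<in> NE_star_paths k n"
  obtain u where u: "u 0 = (0, 0)" "\<And>m. v m = NE_point (u m)"
    "\<And>m. NE.up (u m) (u (Suc m)) \<or> NE.jump (u m) (u (Suc m))"
  proof (rule level_path_lift[of v NE_point "\<lambda>_. True" "\<lambda>x y. NE.up x y \<or> NE.jump x y"])
    show "v 0 = NE_point (0, 0)" using v by (simp add: NE_star_paths_def NE_point_def lh_point_def)
    fix m x assume x: "v m = NE_point x"
    have "north_step (v m) (v (Suc m)) \<or> east_step (v m) (v (Suc m))"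
      using v by (simp add: NE_star_paths_def)
    then have "\<exists>y. v (Suc m) = NE_point y"
      by (auto simp: x NE_point_def north_step_iff east_step_iff)
    then show "\<exists>y. True \<and> v (Suc m) = NE_point y \<and> (NE.up x y \<or> NE.jump x y)"
      using \<open>north_step (v m) (v (Suc m)) \<or> _\<close> x NE_point_north NE_point_east by metis
  qed auto
  have "\<forall>\<^sub>F m in sequentially. fst (v m) = n"
    using v by (intro tends_to_top_eventually) (simp add: NE_star_paths_def)
  then have "\<forall>\<^sub>F m in sequentially. fst (u m) = n - k"
    by eventually_elim (auto simp: u(2) NE_point_def lh_point_def)
  then have "u \<in> ?U"
    using u v by (auto simp: NE.paths_def NE_star_paths_def NE_point_east)
  then show "v \<in> (\<circ>) NE_point ` ?U" using u(2) by (intro image_eqI[of _ _ u]) auto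
next
  fix v assume "v \<in> (\<circ>) NE_point ` ?U"
  then obtain u where u: "u \<in> ?U" "v = NE_point \<circ> u" by blast
  have "tends_to_top v n"
    unfolding u(2) using u(1) kn by (intro NE.paths_tends_to_top) (auto simp: NE_point_def)
  then show "v \<in> NE_star_paths k n"
    using u by (auto simp: NE_star_paths_def NE_point_north NE_point_east NE.paths_def)
      (auto simp: NE_point_def lh_point_def)
qed

private lemma NE_edges_comp: "NE_edges (NE_point \<circ> u) = (\<lambda>(a, c). (k + a, c)) ` NE.jumps u"
proof (rule set_eqI)
  fix e :: "nat \<times> nat"
  obtain i r where e: "e = (i, r)" by (cases e)
  have "e \<in> NE_edges (NE_point \<circ> u) \<longleftrightarrow>
      (\<exists>m. i = k + fst (u m) \<and> r = snd (u m) \<and> fst (u (Suc m)) = Suc (fst (u m)) \<and>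
        snd (u (Suc m)) = east_row i r)"
    by (auto simp: e in_NE_edges_iff NE_point_def)
  also have "\<dots> \<longleftrightarrow> e \<in> (\<lambda>(a, c). (k + a, c)) ` NE.jumps u"
    by (auto simp: e NE.jumps_def image_iff prod_eq_iff)
  finally show "e \<in> NE_edges (NE_point \<circ> u) \<longleftrightarrow> e \<in> (\<lambda>(a, c). (k + a, c)) ` NE.jumps u" .
qed

lemma inj_on_NE_edges: "inj_on NE_edges (NE_star_paths k n)"
proof -
  have "inj_on ((`) (\<lambda>(a, c). (k + a, c)) \<circ> NE.jumps) (NE.paths (n - k))"
    by (intro comp_inj_on NE.inj_on_jumps inj_on_image) (auto simp: inj_on_def)
  then have "inj_on (NE_edges \<circ> (\<circ>) NE_point) (NE.paths (n - k))"
    by (simp add: comp_def NE_edges_comp[unfolded comp_def])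
  then have "inj_on NE_edges ((\<circ>) NE_point ` NE.paths (n - k))"
    by (rule inj_on_imageI)
  then show ?thesis unfolding NE_star_paths_eq by (rule inj_on_subset) auto
qed

private lemma code_edges_shift:
  "code_edges k n z = (\<lambda>(a, c). (k + a, c)) ` (\<lambda>a. (a, z (k + a))) ` {..<n - k}"
proof -
  have "{k..<n} = (\<lambda>a. k + a) ` {..<n - k}"
    using kn by (simp add: lessThan_atLeast0)
  then show ?thesis by (simp add: code_edges_def image_image)
qed

text \<open>Compatibility gives weak inequalities between successive rows, and the ban on
  consecutive east steps excludes equality; this is the strict condition of \<open>NE_codes\<close>.
  Conversely \<open>walk\<close> realises each code.\<close>

lemma NE_edges_image: "NE_edges ` NE_star_paths k n = code_edges k n ` NE_codes k n"
proof (intro equalityI subsetI)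
  fix S assume "S \<in> NE_edges ` NE_star_paths k n"
  then obtain u where u: "u \<in> NE.paths (n - k)" "S = NE_edges (NE_point \<circ> u)"
    "\<not> (\<exists>m. NE.jump (u m) (u (Suc m)) \<and> NE.jump (u (Suc m)) (u (Suc (Suc m))))"
    unfolding NE_star_paths_eq by blast
  obtain x where x: "NE.compatible (n - k) x" "NE.jumps u = (\<lambda>a. (a, x a)) ` {..<n - k}"
    using NE.jumps_path[OF u(1)] .
  have less: "east_row (k + a) (x a) < x (Suc a)" if "Suc a < n - k" for a
    using x(1) NE.consecutive_jumps_iff[OF u(1) x(2)] u(3) that
    by (auto simp: NE.compatible_def order.strict_iff_order)
  define z where "z = restrict (\<lambda>i. x (i - k)) {k..<n}"
  have "z \<in> NE_codes k n"
    unfolding NE_codes_def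
  proof (intro CollectI conjI allI impI)
    fix i assume "k \<le> i \<and> Suc i < n"
    then show "east_row i (z i) < z (Suc i)"
      using less[of "i - k"] kn by (auto simp: z_def Suc_diff_le)
  qed (simp add: z_def)
  moreover have "S = code_edges k n z"
    unfolding u(2) NE_edges_comp x(2) code_edges_shift
    by (intro image_cong refl) (auto simp: z_def)
  ultimately show "S \<in> code_edges k n ` NE_codes k n" by blast
next
  fix S assume "S \<in> code_edges k n ` NE_codes k n"
  then obtain z where z: "z \<in> NE_codes k n" "S = code_edges k n z" by blast
  define x where "x a = z (k + a)" for a
  have less: "east_row (k + a) (x a) < x (Suc a)" if "Suc a < n - k" for a
    using z(1) that by (auto simp: NE_codes_def x_def)
  then have x: "NE.compatible (n - k) x"
    unfolding NE.compatible_def by (blast intro: less_imp_le)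
  define u where "u = NE.walk (n - k) x"
  note u = NE.walk_paths[OF x, folded u_def]
  have "NE_point \<circ> u \<in> NE_star_paths k n"
    unfolding NE_star_paths_eq using u(1) NE.consecutive_jumps_iff[OF u] less by fastforce
  moreover have "S = NE_edges (NE_point \<circ> u)"
    unfolding z(2) NE_edges_comp u(2) code_edges_shift x_def ..
  ultimately show "S \<in> NE_edges ` NE_star_paths k n" by blast
qed

section \<open>The \<open>SE\<close> paths and their codes\<close>

text \<open>\<open>SE\<close> paths are indexed backwards from column \<open>n\<close>, so level \<open>a\<close> is column \<open>n - a\<close>.\<close>

interpretation SE: level_graph "\<lambda>a c. east_row (n - Suc a) c" "\<lambda>a c. c"
  by unfold_locales (simp add: inj_east_row)

text \<open>Truncated subtraction would send all levels from \<open>n\<close> on to column 0, so the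
  lemmas about this map assume levels at most \<open>n\<close>.\<close>

private definition SE_point :: "nat \<times> nat \<Rightarrow> nat \<times> real" where
  "SE_point x = lh_point (n - fst x) (snd x)"

private lemma level_diff_iff: "a \<le> n \<Longrightarrow> b \<le> n \<Longrightarrow> n - a = Suc (n - b) \<longleftrightarrow> b = Suc a"
  by arith

private lemma SE_point_south:
  "fst x \<le> n \<Longrightarrow> fst y \<le> n \<Longrightarrow> south_step (SE_point y) (SE_point x) \<longleftrightarrow> SE.up x y"
  by (cases x; cases y) (auto simp: south_step_iff_north_step north_step_iff SE.up_def SE_point_def)

private lemma SE_point_east:
  "fst x \<le> n \<Longrightarrow> fst y \<le> n \<Longrightarrow> east_step (SE_point y) (SE_point x) \<longleftrightarrow> SE.jump x y"
  by (cases x; cases y) (auto simp: east_step_iff SE.jump_def SE_point_def level_diff_iff)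

private lemma SE_paths_eq: "SE_paths k n = (\<circ>) SE_point ` SE.paths (n - k)"
proof (intro equalityI subsetI)
  fix v assume v: "v \<in> SE_paths k n"
  obtain u where u: "u 0 = (0, 0)" "\<And>m. v m = SE_point (u m)" "\<And>m. fst (u m) \<le> n"
    "\<And>m. SE.up (u m) (u (Suc m)) \<or> SE.jump (u m) (u (Suc m))"
  proof (rule level_path_lift[of v SE_point "\<lambda>x. fst x \<le> n" "\<lambda>x y. SE.up x y \<or> SE.jump x y"])
    show "v 0 = SE_point (0, 0)" using v by (simp add: SE_paths_def SE_point_def lh_point_def)
    fix m x assume x: "fst x \<le> n" "v m = SE_point x"
    have st: "south_step (v (Suc m)) (v m) \<or> east_step (v (Suc m)) (v m)"
      using v by (simp add: SE_paths_def)
    \<comment> \<open>Read backwards, a step keeps the column or lowers it, so columns never exceed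
      \<open>n\<close> and \<open>n - i\<close> is a faithful level.\<close>
    then have "\<exists>i r. v (Suc m) = lh_point i r \<and> i \<le> n"
      by (auto simp: x SE_point_def south_step_iff_north_step north_step_iff east_step_iff)
    then obtain i r where "v (Suc m) = lh_point i r" "i \<le> n" by blast
    then have "v (Suc m) = SE_point (n - i, r)" "fst (n - i, r) \<le> n"
      by (auto simp: SE_point_def)
    then show "\<exists>y. fst y \<le> n \<and> v (Suc m) = SE_point y \<and> (SE.up x y \<or> SE.jump x y)"
      using st x SE_point_south SE_point_east by metis
  qed auto
  have "\<forall>\<^sub>F m in sequentially. fst (v m) = k"
    using v by (intro tends_to_top_eventually) (simp add: SE_paths_def)
  then have "\<forall>\<^sub>F m in sequentially. fst (u m) = n - k"
    by eventually_elim (use u(3) in \<open>auto simp: u(2) SE_point_def lh_point_def\<close>)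
  then have "u \<in> SE.paths (n - k)"
    using u by (auto simp: SE.paths_def)
  then show "v \<in> (\<circ>) SE_point ` SE.paths (n - k)" using u(2) by (intro image_eqI[of _ _ u]) auto
next
  fix v assume "v \<in> (\<circ>) SE_point ` SE.paths (n - k)"
  then obtain u where u: "u \<in> SE.paths (n - k)" "v = SE_point \<circ> u" by blast
  have le: "fst (u m) \<le> n" for m
    using SE.paths_level_le[OF u(1), of m] by simp
  have "tends_to_top v k"
    unfolding u(2) using u(1) kn by (intro SE.paths_tends_to_top) (auto simp: SE_point_def)
  moreover have "v 0 = (n, 0)"
    using u by (simp add: SE.paths_def SE_point_def lh_point_def)
  moreover have "south_step (v (m + 1)) (v m) \<or> east_step (v (m + 1)) (v m)" for m
    using SE.paths_step[OF u(1), of m] le by (simp add: u(2) SE_point_south SE_point_east)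
  ultimately show "v \<in> SE_paths k n" by (simp add: SE_paths_def)
qed

private lemma SE_edges_comp:
  assumes "u \<in> SE.paths (n - k)"
  shows "SE_edges (SE_point \<circ> u) = (\<lambda>(a, c). (n - Suc a, c)) ` SE.jumps u"
proof (rule set_eqI)
  fix e :: "nat \<times> nat"
  obtain i r where e: "e = (i, r)" by (cases e)
  have le: "fst (u m) \<le> n" for m
    using SE.paths_level_le[OF assms, of m] by simp
  have *: "u m = (a, s) \<Longrightarrow> a \<le> n" for m a s using le[of m] by simp
  have "e \<in> SE_edges (SE_point \<circ> u) \<longleftrightarrow>
      (\<exists>m. i = n - fst (u (Suc m)) \<and> Suc i = n - fst (u m) \<and> snd (u (Suc m)) = r \<and> snd (u m) = east_row i r)"
    by (auto simp: e in_SE_edges_iff SE_point_def)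
  also have "\<dots> \<longleftrightarrow> (\<exists>a m. i = n - Suc a \<and> u m = (a, east_row i r) \<and> u (Suc m) = (Suc a, r))"
  proof (intro iffI; elim exE conjE)
    fix m assume m: "i = n - fst (u (Suc m))" "Suc i = n - fst (u m)" "snd (u (Suc m)) = r"
      "snd (u m) = east_row i r"
    then have "fst (u (Suc m)) = Suc (fst (u m))" using le[of m] le[of "Suc m"] by linarith
    then show "\<exists>a m. i = n - Suc a \<and> u m = (a, east_row i r) \<and> u (Suc m) = (Suc a, r)"
      using m by (intro exI[of _ "fst (u m)"] exI[of _ m]) (simp add: prod_eq_iff)
  next
    fix a m assume m: "i = n - Suc a" "u m = (a, east_row i r)" "u (Suc m) = (Suc a, r)"
    then show "\<exists>m. i = n - fst (u (Suc m)) \<and> Suc i = n - fst (u m) \<and> snd (u (Suc m)) = r \<and>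
        snd (u m) = east_row i r"
      using *[OF m(3)] by (intro exI[of _ m]) simp
  qed
  also have "\<dots> \<longleftrightarrow> e \<in> (\<lambda>(a, c). (n - Suc a, c)) ` SE.jumps u"
    by (auto simp: e SE.jumps_def image_iff)
  finally show "e \<in> SE_edges (SE_point \<circ> u) \<longleftrightarrow> e \<in> (\<lambda>(a, c). (n - Suc a, c)) ` SE.jumps u" .
qed

text \<open>The reversal of levels \<open>n - Suc a\<close> is injective only for
  \<open>a < n\<close>, so the labels must be confined there.\<close>

private lemma SE_jumps_subset: "u \<in> SE.paths (n - k) \<Longrightarrow> SE.jumps u \<subseteq> {..<n} \<times> UNIV"
  by (erule SE.jumps_path) auto

lemma inj_on_SE_edges: "inj_on SE_edges (SE_paths k n)"
proof -
  have "inj_on (\<lambda>(a, c). (n - Suc a, c)) ({..<n} \<times> (UNIV :: nat set))"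
    by (auto simp: inj_on_def)
  then have "inj_on ((`) (\<lambda>(a, c). (n - Suc a, c)) \<circ> SE.jumps) (SE.paths (n - k))"
    using SE_jumps_subset
    by (intro comp_inj_on SE.inj_on_jumps inj_on_image) (blast intro: inj_on_subset)
  then have "inj_on (SE_edges \<circ> (\<circ>) SE_point) (SE.paths (n - k))"
    by (rule inj_on_cong[THEN iffD1, rotated]) (simp add: SE_edges_comp)
  then have "inj_on SE_edges ((\<circ>) SE_point ` SE.paths (n - k))"
    by (rule inj_on_imageI)
  then show ?thesis unfolding SE_paths_eq .
qed

private lemma code_edges_reverse:
  "code_edges k n z = (\<lambda>(a, c). (n - Suc a, c)) ` (\<lambda>a. (a, z (n - Suc a))) ` {..<n - k}"
proof -
  have "{k..<n} = (\<lambda>a. n - Suc a) ` {..<n - k}"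
  proof (intro equalityI subsetI)
    fix i assume "i \<in> {k..<n}"
    then show "i \<in> (\<lambda>a. n - Suc a) ` {..<n - k}"
      by (intro image_eqI[of _ _ "n - Suc i"]) auto
  qed (use kn in auto)
  then show ?thesis by (simp add: code_edges_def image_image)
qed

lemma SE_edges_image: "SE_edges ` SE_paths k n = code_edges k n ` SE_codes k n"
proof (intro equalityI subsetI)
  fix S assume "S \<in> SE_edges ` SE_paths k n"
  then obtain u where u: "u \<in> SE.paths (n - k)" "S = SE_edges (SE_point \<circ> u)"
    unfolding SE_paths_eq by blast
  obtain x where x: "SE.compatible (n - k) x" "SE.jumps u = (\<lambda>a. (a, x a)) ` {..<n - k}"
    using SE.jumps_path[OF u(1)] .
  define z where "z = restrict (\<lambda>i. x (n - Suc i)) {k..<n}"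
  have "z \<in> SE_codes k n"
    unfolding SE_codes_def
  proof (intro CollectI conjI allI impI)
    fix i assume i: "k \<le> i \<and> Suc i < n"
    \<comment> \<open>The east steps starting in columns \<open>Suc i\<close> and \<open>i\<close>
      are the jumps out of levels \<open>n - Suc (Suc i)\<close> and \<open>n - Suc i\<close>, in
      this order of traversal.\<close>
    then have "Suc (n - Suc (Suc i)) = n - Suc i" "n - Suc i < n - k" by arith+
    then show "z (Suc i) \<le> east_row i (z i)"
      using x(1)[unfolded SE.compatible_def, rule_format, of "n - Suc (Suc i)"] i
      by (simp add: z_def)
  qed (simp add: z_def)
  moreover have "S = code_edges k n z"
    unfolding u(2) SE_edges_comp[OF u(1)] x(2) code_edges_reverse
    by (intro image_cong refl) (auto simp: z_def)
  ultimately show "S \<in> code_edges k n ` SE_codes k n" by blast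
next
  fix S assume "S \<in> code_edges k n ` SE_codes k n"
  then obtain z where z: "z \<in> SE_codes k n" "S = code_edges k n z" by blast
  define x where "x a = z (n - Suc a)" for a
  have x: "SE.compatible (n - k) x"
    unfolding SE.compatible_def
  proof (intro allI impI)
    fix a assume a: "Suc a < n - k"
    then have "Suc (n - Suc (Suc a)) = n - Suc a" "k \<le> n - Suc (Suc a)" by simp_all
    then show "x a \<le> east_row (n - Suc (Suc a)) (x (Suc a))"
      using z(1) a unfolding SE_codes_def x_def by force
  qed
  define u where "u = SE.walk (n - k) x"
  note u = SE.walk_paths[OF x, folded u_def]
  have "S = SE_edges (SE_point \<circ> u)"
    unfolding z(2) SE_edges_comp[OF u(1)] u(2) code_edges_reverse x_def ..
  then show "S \<in> SE_edges ` SE_paths k n" unfolding SE_paths_eq using u(1) by blast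
qed

end

subsection \<open>The involution\<close>

text \<open>
  An \<open>NE\<close> code on the columns before \<open>k\<close> and an \<open>SE\<close> code on the columns from \<open>k\<close> on combine into
  one function; the involution moves \<open>k\<close> and keeps this function.
\<close>

definition mixed_codes :: "nat \<Rightarrow> nat \<Rightarrow> nat \<Rightarrow> (nat \<Rightarrow> nat) set" where
  "mixed_codes m k n = {z \<in> {m..<n} \<rightarrow>\<^sub>E UNIV.
     (\<forall>i. m \<le> i \<and> Suc i < k \<longrightarrow> east_row i (z i) < z (Suc i)) \<and>
     (\<forall>i. k \<le> i \<and> Suc i < n \<longrightarrow> z (Suc i) \<le> east_row i (z i))}"

text \<open>No condition in \<open>mixed_codes\<close> relates the rows in columns
  \<open>k - 1\<close> and \<open>k\<close>, so the two parts can be chosen independently. This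
  missing comparison is what the involution exploits.\<close>

lemma bij_betw_merge_codes:
  assumes "m \<le> k" "k \<le> n"
  shows "bij_betw (\<lambda>(x, y) i. if i < k then y i else x i) (SE_codes k n \<times> NE_codes m k) (mixed_codes m k n)"
proof (rule bij_betw_byWitness[where f' = "\<lambda>z. (restrict z {k..<n}, restrict z {m..<k})"])
  show "\<forall>p\<in>SE_codes k n \<times> NE_codes m k.
      (\<lambda>z. (restrict z {k..<n}, restrict z {m..<k})) ((\<lambda>(x, y) i. if i < k then y i else x i) p) = p"
    by (auto simp: SE_codes_def NE_codes_def PiE_iff extensional_def restrict_def fun_eq_iff)
  show "\<forall>z\<in>mixed_codes m k n.
      (\<lambda>(x, y) i. if i < k then y i else x i) (restrict z {k..<n}, restrict z {m..<k}) = z"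
    using assms by (auto simp: mixed_codes_def PiE_iff extensional_def restrict_def fun_eq_iff)
  show "(\<lambda>(x, y) i. if i < k then y i else x i) ` (SE_codes k n \<times> NE_codes m k) \<subseteq> mixed_codes m k n"
    using assms by (auto simp: SE_codes_def NE_codes_def mixed_codes_def PiE_iff extensional_def)
  show "(\<lambda>z. (restrict z {k..<n}, restrict z {m..<k})) ` mixed_codes m k n \<subseteq> SE_codes k n \<times> NE_codes m k"
    using assms by (auto simp: SE_codes_def NE_codes_def mixed_codes_def PiE_iff extensional_def)
qed

definition code_weight :: "(nat \<Rightarrow> nat \<Rightarrow> nat \<Rightarrow> 'k::field) \<Rightarrow> nat \<Rightarrow> nat \<Rightarrow> (nat \<Rightarrow> nat) \<Rightarrow> 'k" where
  "code_weight w k n z = (\<Prod>i\<in>{k..<n}. edge_weight w (i, z i))"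

lemma code_weight_code_edges: "code_weight w k n z = prod (edge_weight w) (code_edges k n z)"
  by (simp add: code_weight_def code_edges_def prod.reindex inj_on_def)

lemma code_weight_merge:
  assumes "m \<le> k" "k \<le> n"
  shows "code_weight w m n (\<lambda>i. if i < k then y i else x i) = code_weight w k n x * code_weight w m k y"
  unfolding code_weight_def prod.atLeastLessThan_concat[OF assms, symmetric]
  by (simp add: mult.commute)

text \<open>The last east step of the \<open>NE\<close> part can be handed to the \<open>SE\<close>
  part: there is such a step, and either the \<open>SE\<close> part is empty or the step satisfies
  its inequality there.\<close>

definition removable :: "nat \<Rightarrow> nat \<Rightarrow> nat \<times> (nat \<Rightarrow> nat) \<Rightarrow> bool" where
  "removable m n = (\<lambda>(k, z). m < k \<and> (k = n \<or> z k \<le> east_row (k - 1) (z (k - 1))))"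

text \<open>The conditions are complementary: after lowering \<open>k\<close>, the strict inequality
  left in the \<open>NE\<close> part blocks a second lowering, and a code that cannot be lowered
  satisfies the inequality needed to raise \<open>k\<close>. The assumption \<open>m < n\<close>
  excludes \<open>k = m = n\<close>, where neither move exists.\<close>

lemma bij_betw_removable:
  assumes "m < n"
  shows "bij_betw (\<lambda>(k, z). (k - 1, z))
    {p \<in> Sigma {m..n} (\<lambda>k. mixed_codes m k n). removable m n p}
    {p \<in> Sigma {m..n} (\<lambda>k. mixed_codes m k n). \<not> removable m n p}"
    (is "bij_betw ?f ?A ?B")
proof (rule bij_betw_byWitness[where f' = "\<lambda>(k, z). (Suc k, z)"])
  show "\<forall>p\<in>?A. (\<lambda>(k, z). (Suc k, z)) (?f p) = p"
    by (auto simp: removable_def)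
  show "\<forall>p\<in>?B. ?f ((\<lambda>(k, z). (Suc k, z)) p) = p"
    by auto
  show "?f ` ?A \<subseteq> ?B"
  proof clarify
    fix k z assume k: "k \<in> {m..n}" and z: "z \<in> mixed_codes m k n" and r: "removable m n (k, z)"
    obtain l where l: "k = Suc l" "m \<le> l" using r by (cases k) (auto simp: removable_def)
    \<comment> \<open>The only new condition is at \<open>i = l\<close>, and it is the one recorded
      in \<open>removable\<close>.\<close>
    have "z (Suc i) \<le> east_row i (z i)" if "l \<le> i" "Suc i < n" for i
      using that r z l by (cases "i = l") (auto simp: removable_def mixed_codes_def)
    then have "z \<in> mixed_codes m l n"
      using z by (auto simp: mixed_codes_def l)
    moreover have "\<not> removable m n (l, z)"
    proof
      assume "removable m n (l, z)"
      then obtain i where i: "l = Suc i" "m \<le> i" "z l \<le> east_row i (z i)"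
        using k l by (cases l) (auto simp: removable_def)
      have "east_row i (z i) < z (Suc i)"
        using z i by (auto simp: mixed_codes_def l)
      then show False using i by simp
    qed
    ultimately show "(k - 1, z) \<in> Sigma {m..n} (\<lambda>k. mixed_codes m k n) \<and> \<not> removable m n (k - 1, z)"
      using k l by auto
  qed
  show "(\<lambda>(k, z). (Suc k, z)) ` ?B \<subseteq> ?A"
  proof clarify
    fix k z assume k: "k \<in> {m..n}" and z: "z \<in> mixed_codes m k n" and r: "\<not> removable m n (k, z)"
    have "k < n" using r k assms by (auto simp: removable_def)
    \<comment> \<open>The only new condition is at \<open>Suc i = k\<close>, and it is the failure
      of \<open>removable\<close>.\<close>
    have "east_row i (z i) < z (Suc i)" if "m \<le> i" "i < k" for i
      using that r z by (cases "k = Suc i") (auto simp: removable_def mixed_codes_def)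
    then have "z \<in> mixed_codes m (Suc k) n"
      using z by (auto simp: mixed_codes_def)
    moreover have "removable m n (Suc k, z)"
      using k \<open>k < n\<close> z by (auto simp: removable_def mixed_codes_def)
    ultimately show "(Suc k, z) \<in> Sigma {m..n} (\<lambda>k. mixed_codes m k n) \<and> removable m n (Suc k, z)"
      using k \<open>k < n\<close> by auto
  qed
qed

section \<open>Formal sums over codes and the inverse relation\<close>

context formal_ring
begin

lemma code_weight_closed:
  assumes "admissible_weights R \<I> w"
  shows "code_weight w k n z \<in> R"
  unfolding code_weight_def edge_weight_def prod.case
proof (rule prod_closed)
  fix i
  have "z i mod Suc i \<le> i" using mod_less_divisor[of "Suc i" "z i"] by linarith
  then show "w (z i div Suc i) i (z i mod Suc i) \<in> R"
    using assms unfolding admissible_weights_def by blast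
qed

text \<open>The sum is reindexed twice, from paths to their sets of east edges and from these to
  codes.\<close>

lemma has_formal_sum_lh_h:
  assumes "admissible_weights R \<I> w" "k \<le> n"
  shows "has_formal_sum \<I> (code_weight w k n) (SE_codes k n) (lh_h \<I> w n k)"
proof -
  obtain s where s: "has_formal_sum \<I> (SE_weight w) (SE_paths k n) s"
    using assms(1) unfolding admissible_weights_def formally_summable_def by blast
  have "SE_weight w = prod (edge_weight w) \<circ> SE_edges"
    by (simp add: fun_eq_iff SE_weight_def SE_edges_def steps_weight_east_edges)
  then have "has_formal_sum \<I> (prod (edge_weight w)) (code_edges k n ` SE_codes k n) s"
    using s has_formal_sum_reindex[OF inj_on_SE_edges[OF assms(2)]]
    by (simp add: SE_edges_image[OF assms(2)])
  moreover have "inj_on (code_edges k n) (SE_codes k n)"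
    by (rule inj_on_subset[OF inj_on_code_edges]) (auto simp: SE_codes_def)
  moreover have "code_weight w k n = prod (edge_weight w) \<circ> code_edges k n"
    by (simp add: fun_eq_iff code_weight_code_edges)
  moreover have "lh_h \<I> w n k = s"
    unfolding lh_h_def using s by (rule formal_sum_eq)
  ultimately show ?thesis using has_formal_sum_reindex by metis
qed

lemma has_formal_sum_lh_e:
  assumes "admissible_weights R \<I> w" "k \<le> n"
  shows "has_formal_sum \<I> (code_weight w k n) (NE_codes k n) (lh_e \<I> w n k)"
proof -
  obtain s where s: "has_formal_sum \<I> (NE_weight w) (NE_star_paths k n) s"
    using assms(1) unfolding admissible_weights_def formally_summable_def by blast
  have "NE_weight w = prod (edge_weight w) \<circ> NE_edges"
    by (simp add: fun_eq_iff NE_weight_def NE_edges_def steps_weight_east_edges)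
  then have "has_formal_sum \<I> (prod (edge_weight w)) (code_edges k n ` NE_codes k n) s"
    using s has_formal_sum_reindex[OF inj_on_NE_edges[OF assms(2)]]
    by (simp add: NE_edges_image[OF assms(2)])
  moreover have "inj_on (code_edges k n) (NE_codes k n)"
    by (rule inj_on_subset[OF inj_on_code_edges]) (auto simp: NE_codes_def)
  moreover have "code_weight w k n = prod (edge_weight w) \<circ> code_edges k n"
    by (simp add: fun_eq_iff code_weight_code_edges)
  moreover have "lh_e \<I> w n k = s"
    unfolding lh_e_def using s by (rule formal_sum_eq)
  ultimately show ?thesis using has_formal_sum_reindex by metis
qed

lemma has_formal_sum_mixed_codes:
  assumes w: "admissible_weights R \<I> w" and "m \<le> k" "k \<le> n"
  shows "has_formal_sum \<I> (code_weight w m n) (mixed_codes m k n) (lh_h \<I> w n k * lh_e \<I> w k m)"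
proof -
  let ?merge = "\<lambda>(x, y) i. if i < k then y i else (x i :: nat)"
  note bij = bij_betw_merge_codes[OF assms(2,3)]
  have "has_formal_sum \<I> (\<lambda>(x, y). code_weight w k n x * code_weight w m k y)
      (SE_codes k n \<times> NE_codes m k) (lh_h \<I> w n k * lh_e \<I> w k m)"
    using assms by (intro has_formal_sum_times has_formal_sum_lh_h has_formal_sum_lh_e code_weight_closed)
  also have "(\<lambda>(x, y). code_weight w k n x * code_weight w m k y) = code_weight w m n \<circ> ?merge"
    by (simp add: fun_eq_iff code_weight_merge[OF assms(2,3)])
  finally show ?thesis
    unfolding has_formal_sum_reindex[OF bij_betw_imp_inj_on[OF bij], symmetric]
      bij_betw_imp_surj_on[OF bij] .
qed

lemma lh_diagonal:
  assumes "admissible_weights R \<I> w"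
  shows "lh_h \<I> w n n = 1" "lh_e \<I> w n n = 1"
proof -
  \<comment> \<open>On an empty range of columns the only extensional function is constantly
    \<open>undefined\<close>; it encodes the vertical path.\<close>
  have codes: "SE_codes n n = {\<lambda>_. undefined}" "NE_codes n n = {\<lambda>_. undefined}"
    by (auto simp: SE_codes_def NE_codes_def)
  have one: "has_formal_sum \<I> (code_weight w n n) {\<lambda>_. undefined} 1"
    by (intro has_formal_sumI exI[of _ "{\<lambda>_. undefined}"]) (simp add: code_weight_def ideal_zero)
  show "lh_h \<I> w n n = 1"
    using has_formal_sum_lh_h[OF assms, of n n] one unfolding codes by (auto intro: has_formal_sum_unique)
  show "lh_e \<I> w n n = 1"
    using has_formal_sum_lh_e[OF assms, of n n] one unfolding codes by (auto intro: has_formal_sum_unique)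
qed

text \<open>The matrix product is one formal sum over pairs of \<open>k\<close> and a merged code.
  The involution keeps the weight, which depends on the code alone, and shifts \<open>k\<close> by
  one, which flips the sign.\<close>

lemma lh_h_lh_e_inverse:
  assumes w: "admissible_weights R \<I> w" and "m \<le> n"
  shows "(\<Sum>k=m..n. lh_h \<I> w n k * ((- 1) ^ (k - m) * lh_e \<I> w k m)) = (if n = m then 1 else 0)"
proof (cases "n = m")
  case True
  then show ?thesis using lh_diagonal[OF w] by simp
next
  case False
  then have "m < n" using \<open>m \<le> n\<close> by simp
  let ?f = "\<lambda>(k, z). (- 1) ^ (k - m) * code_weight w m n z"
  have "has_formal_sum \<I> ?f (Sigma {m..n} (\<lambda>k. mixed_codes m k n))
      (\<Sum>k=m..n. (- 1) ^ (k - m) * (lh_h \<I> w n k * lh_e \<I> w k m))"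
  proof (rule has_formal_sum_Sigma_finite)
    fix k assume "k \<in> {m..n}"
    then have "has_formal_sum \<I> (\<lambda>z. (- 1) ^ (k - m) * code_weight w m n z) (mixed_codes m k n)
        ((- 1) ^ (k - m) * (lh_h \<I> w n k * lh_e \<I> w k m))"
      by (intro has_formal_sum_cmult has_formal_sum_mixed_codes w power_closed uminus_closed one_closed) auto
    then show "has_formal_sum \<I> (\<lambda>z. ?f (k, z)) (mixed_codes m k n)
        ((- 1) ^ (k - m) * (lh_h \<I> w n k * lh_e \<I> w k m))" by simp
  qed simp
  then have "(\<Sum>k=m..n. (- 1) ^ (k - m) * (lh_h \<I> w n k * lh_e \<I> w k m)) = 0"
  proof (rule has_formal_sum_cancel[OF _ bij_betw_removable[OF \<open>m < n\<close>]])
    fix p assume "removable m n p"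
    then obtain l z where "p = (Suc l, z)" "m \<le> l"
      by (cases p; cases "fst p") (auto simp: removable_def)
    then show "?f ((\<lambda>(k, z). (k - 1, z)) p) = - ?f p" by (simp add: Suc_diff_le)
  qed
  then show ?thesis using False by (simp add: mult.left_commute)
qed

end

theorem proposition2p8:
  fixes R :: "'k::field set" and \<I> :: "'k set set"
    and p q :: "nat \<Rightarrow> 'k poly" and \<sigma> \<nu> :: "nat \<Rightarrow> nat \<Rightarrow> 'k"
    and w :: "nat \<Rightarrow> nat \<Rightarrow> nat \<Rightarrow> 'k"
  assumes "formal_ring R \<I>"
    and "polynomial_sequence p" and "polynomial_sequence q"
    and "mixed_moments p q \<sigma>" and "mixed_coefficients p q \<nu>"
    and "admissible_weights R \<I> w"
  shows "((\<forall>n k. k \<le> n \<longrightarrow> \<sigma> n k = lh_h \<I> w n k) \<longrightarrow>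
            (\<forall>n k. k \<le> n \<longrightarrow> \<nu> n k = (- 1) ^ (n - k) * lh_e \<I> w n k)) \<and>
         ((\<forall>n k. k \<le> n \<longrightarrow> \<nu> n k = (- 1) ^ (n - k) * lh_e \<I> w n k) \<longrightarrow>
            (\<forall>n k. k \<le> n \<longrightarrow> \<sigma> n k = lh_h \<I> w n k))"
proof -
  interpret formal_ring R \<I> by fact
  note \<nu>\<sigma> = mixed_coefficients_moments_inverse[OF assms(2,4,5)]
  note he = lh_h_lh_e_inverse[OF assms(6)]
  show ?thesis
  proof (intro conjI impI allI)
    fix n k :: nat
    assume \<sigma>: "\<forall>n k. k \<le> n \<longrightarrow> \<sigma> n k = lh_h \<I> w n k" and "k \<le> n"
    show "\<nu> n k = (- 1) ^ (n - k) * lh_e \<I> w n k"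
    \<comment> \<open>Here \<open>\<nu>\<close> is a left inverse and the signed \<open>lh_e\<close>
      a right inverse of \<open>lh_h\<close>, which equals \<open>\<sigma>\<close>.\<close>
    proof (rule triangular_inverse_unique[OF _ he \<open>k \<le> n\<close>])
      fix n m :: nat assume "m \<le> n"
      then show "(\<Sum>k=m..n. \<nu> n k * lh_h \<I> w k m) = (if n = m then 1 else 0)"
        using \<nu>\<sigma>[of m n] \<sigma> by simp
    qed
  next
    fix n k :: nat
    assume \<nu>: "\<forall>n k. k \<le> n \<longrightarrow> \<nu> n k = (- 1) ^ (n - k) * lh_e \<I> w n k" and "k \<le> n"
    show "\<sigma> n k = lh_h \<I> w n k"
    \<comment> \<open>Now the middle matrix is the signed \<open>lh_e\<close>, which equals
      \<open>\<nu>\<close>: it has left inverse \<open>lh_h\<close> and right inverse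
      \<open>\<sigma>\<close>.\<close>
    proof (rule triangular_inverse_unique[OF he _ \<open>k \<le> n\<close>, symmetric])
      fix n m :: nat assume "m \<le> n"
      then show "(\<Sum>k=m..n. (- 1) ^ (n - k) * lh_e \<I> w n k * \<sigma> k m) = (if n = m then 1 else 0)"
        using \<nu>\<sigma>[of m n] \<nu> by simp
    qed
  qed
qed

end
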